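(* For every $d\in\mathbb{N}$, the full-dimensional simplices determined by a set $S$ of $n$ points in $\mathbb{R}^d$, not all on a hyperplane, have at least $\Omega(n)$ distinct volumes. Furthermore, $S$ spans a $(d-1)$-dimensional simplex $F$ such that $S$ determines $\Omega(n)$ full-dimensional simplices of pairwise distinct volumes having $F$ as a common face.
   Context: A full-dimensional simplex determined by $S\subset\mathbb{R}^d$ is a $d$-dimensional simplex whose $d+1$ affinely independent vertices are points of $S$ (so its volume is positive). A $(d-1)$-dimensional simplex spanned by $S$ has $d$ affinely independent points of $S$ as its vertices. The constants hidden in $\Omega(\cdot)$ depend only on $d$. *)

theory Defs
  imports "HOL-Analysis.Analysis"
begin

definition spanned_simplices :: "int \<Rightarrow> 'a::euclidean_space set \<Rightarrow> 'a set set" where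
  "spanned_simplices k S =
     {convex hull V |V. V \<subseteq> S \<and> \<not> affine_dependent V \<and> int (card V) = k + 1}"

lemma spanned_simplices_simplex: "T \<in> spanned_simplices k S \<Longrightarrow> k simplex T"
  unfolding spanned_simplices_def simplex_def by blast

definition full_simplices :: "(real ^ 'd) set \<Rightarrow> (real ^ 'd) set set" where
  "full_simplices S = spanned_simplices (int CARD('d)) S"

definition on_hyperplane :: "'a::euclidean_space set \<Rightarrow> bool" where
  "on_hyperplane S \<longleftrightarrow> (\<exists>a b. a \<noteq> 0 \<and> S \<subseteq> {x. a \<bullet> x = b})"

end

theory Submission
  imports Defs
begin

text \<open>
  Replace \<open>S\<close> by \<open>T = S \<times> {1}\<close>, so that flats become linear subspaces.  If some proper subspace contains
  a positive proportion of \<open>T\<close>, recurse inside it; so assume that none does.  Choose linearly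
  independent points \<open>p\<^sub>1, p\<^sub>2, \<dots>\<close> of \<open>T\<close> one at a time, keeping the number of pairs \<open>(s, t)\<close> with
  \<open>s - t\<close> in their span \<open>U\<close> of order \<open>n\<close>.  For the final hyperplane \<open>U\<close>, the Cauchy--Schwarz inequality
  then gives \<open>\<Omega>(n)\<close> parallel translates of \<open>U\<close> that meet \<open>T\<close>, hence \<open>\<Omega>(n)\<close> distinct heights over the
  facet spanned by the chosen points.

  Different extensions of \<open>U\<close> by a point of \<open>T\<close> create disjoint sets of new pairs, so only a few
  extensions are bad as soon as \<open>U\<close> has \<open>\<Omega>(n)\<close> of them.  After projecting from \<open>U\<close> to a plane, this
  becomes a weak form of Beck's theorem: if no line is rich, a positive proportion of the points lies on
  \<open>\<Omega>(n)\<close> connecting lines.  To see this, cut the points by two lines into four parts of size \<open>\<Omega>(n)\<close>.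
  Every line misses one of the parts, so iterating a weighted Cauchy--Schwarz inequality shows that the
  lines with more than a constant number of points carry only a small proportion of all pairs.
\<close>

subsection \<open>Simplices over a fixed facet\<close>

text \<open>\<open>content_simplex\<close> requires a well-ordered index type; this copy of a finite type supplies one.\<close>
typedef 'a ordered_copy = "UNIV :: 'a set" ..

instance ordered_copy :: (finite) finite
proof
  have "range Abs_ordered_copy = (UNIV :: 'a ordered_copy set)"
    by (metis Rep_ordered_copy_inverse surjI)
  then show "finite (UNIV :: 'a ordered_copy set)"
    by (metis finite finite_imageI)
qed

instantiation ordered_copy :: (finite) linorder
begin

definition less_eq_ordered_copy :: "'a ordered_copy \<Rightarrow> 'a ordered_copy \<Rightarrow> bool" where
  "x \<le> y \<longleftrightarrow> to_nat (Rep_ordered_copy x) \<le> to_nat (Rep_ordered_copy y)"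

definition less_ordered_copy :: "'a ordered_copy \<Rightarrow> 'a ordered_copy \<Rightarrow> bool" where
  "x < y \<longleftrightarrow> to_nat (Rep_ordered_copy x) < to_nat (Rep_ordered_copy y)"

instance
  by standard (auto simp: less_eq_ordered_copy_def less_ordered_copy_def Rep_ordered_copy_inject)

end

instance ordered_copy :: (finite) wellorder
proof (rule wf_wellorderI)
  have "{(x :: 'a ordered_copy, y). x < y} = inv_image less_than (\<lambda>x. to_nat (Rep_ordered_copy x))"
    by (auto simp: less_ordered_copy_def)
  then show "wf {(x :: 'a ordered_copy, y). x < y}"
    by simp
qed intro_classes

text \<open>Multilinearity in one row: with the other vertices fixed, the signed volume is linear in
  the edge vector to the moving vertex.\<close>

lemma det_replaced_row_linear:
  fixes r :: "'n::finite \<Rightarrow> real ^ 'n"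
  shows "linear (\<lambda>v. det (\<chi> j. if j = k then v else r j))"
proof (rule linearI)
  fix v w :: "real ^ 'n" and c :: real
  show "det (\<chi> j. if j = k then v + w else r j) =
      det (\<chi> j. if j = k then v else r j) + det (\<chi> j. if j = k then w else r j)"
    using det_row_add[of k "\<lambda>_. v" "\<lambda>_. w" r] by simp
  show "det (\<chi> j. if j = k then c *\<^sub>R v else r j) = c *\<^sub>R det (\<chi> j. if j = k then v else r j)"
    using det_row_mul[of k c "\<lambda>_. v" r] unfolding scalar_mult_eq_scaleR by simp
qed

text \<open>Up to sign, the volume is 1/d! times the determinant of the edge vectors at a vertex
  \<open>p0\<close> of \<open>F\<close>. Only one of these edges involves \<open>x\<close>, so the
  determinant is a linear functional of \<open>x - p0\<close>, represented by
  \<open>\<nu>\<close>.\<close>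

lemma simplex_content_affine_wellorder:
  fixes F :: "(real ^ 'n::{finite,wellorder}) set"
  assumes "finite F" and F: "card F = CARD('n)"
  shows "\<exists>\<nu> b. (\<forall>p\<in>F. \<nu> \<bullet> p = b) \<and>
    (\<forall>x. x \<notin> F \<longrightarrow> measure lborel (convex hull (insert x F)) = \<bar>\<nu> \<bullet> x - b\<bar>)"
proof -
  obtain p0 where p0: "p0 \<in> F"
    using assms by (metis card.empty ex_in_conv zero_less_card_finite less_irrefl)
  \<comment> \<open>Row \<open>k\<close> is reserved for the moving vertex; the other rows hold the
    edges from \<open>p0\<close> to the rest of \<open>F\<close>.\<close>
  fix k :: 'n
  have "card (UNIV - {k}) = card (F - {p0})"
    using assms p0 by simp
  then obtain f where f: "bij_betw f (UNIV - {k}) (F - {p0})"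
    using \<open>finite F\<close> finite_same_card_bij[of "UNIV - {k}" "F - {p0}"] by auto
  define L where "L v = det (\<chi> j. if j = k then v else f j - p0)" for v
  have lin: "linear L"
    unfolding L_def by (rule det_replaced_row_linear)
  define \<nu> where "\<nu> = (1 / fact CARD('n)) *\<^sub>R adjoint L 1"
  have \<nu>: "\<nu> \<bullet> v = L v / fact CARD('n)" for v
    using adjoint_works[OF lin, of v 1] by (simp add: \<nu>_def inner_commute)
  have on: "\<nu> \<bullet> p = \<nu> \<bullet> p0" if "p \<in> F" for p
  proof (cases "p = p0")
    case False
    then have "p \<in> f ` (UNIV - {k})"
      using that by (simp add: bij_betw_imp_surj_on[OF f])
    then obtain j where j: "j \<noteq> k" "f j = p"
      by auto
    \<comment> \<open>The vector \<open>p - p0\<close> already stands in row \<open>j\<close>, so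
      two rows agree.\<close>
    have "L (p - p0) = 0"
      unfolding L_def by (rule det_identical_rows[of k j]) (use j in \<open>auto simp: row_def vec_eq_iff\<close>)
    then show ?thesis
      using \<nu>[of "p - p0"] by (simp add: inner_diff_right)
  qed auto
  have "measure lborel (convex hull (insert x F)) = \<bar>\<nu> \<bullet> x - \<nu> \<bullet> p0\<bar>" if "x \<notin> F" for x
  proof -
    define g where "g j = (if j = k then x else f j)" for j
    have "bij_betw g (insert k (UNIV - {k})) (insert x (F - {p0}))"
    proof (subst bij_betw_cong[of _ g "\<lambda>j. if j \<in> {k} then x else f j"])
      show "bij_betw (\<lambda>j. if j \<in> {k} then x else f j) (insert k (UNIV - {k})) (insert x (F - {p0}))"
        using bij_betw_disjoint_Un[of "\<lambda>_. x" "{k}" "{x}" f "UNIV - {k}" "F - {p0}"] f that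
        by (auto simp: bij_betw_def)
    qed (auto simp: g_def)
    moreover have "insert x (F - {p0}) = insert x F - {p0}"
      using that p0 by auto
    moreover have "insert k (UNIV - {k}) = UNIV" by auto
    ultimately have g: "bij_betw g UNIV (insert x F - {p0})" by simp
    have "measure lborel (convex hull (insert x F)) = \<bar>det (\<chi> i. \<chi> j. g j $ i - p0 $ i)\<bar> / fact CARD('n)"
      by (rule content_simplex) (use g assms that p0 in auto)
    \<comment> \<open>\<open>content_simplex\<close> puts the edge vectors into columns, whereas
      \<open>L\<close> has them as rows.\<close>
    also have "(\<chi> i. \<chi> j. g j $ i - p0 $ i) = transpose (\<chi> j. if j = k then x - p0 else f j - p0)"
      by (auto simp: transpose_def g_def vec_eq_iff)
    finally show ?thesis
      using \<nu>[of "x - p0"] by (simp add: L_def inner_diff_right det_transpose)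
  qed
  with on show ?thesis by blast
qed

section \<open>Transport of Lebesgue measure along a relabelling of coordinates\<close>

definition copy_vec :: "real ^ 'n \<Rightarrow> real ^ ('n::finite) ordered_copy" where
  "copy_vec v = (\<chi> i. v $ Rep_ordered_copy i)"

definition uncopy_vec :: "real ^ ('n::finite) ordered_copy \<Rightarrow> real ^ 'n" where
  "uncopy_vec v = (\<chi> i. v $ Abs_ordered_copy i)"

lemma copy_uncopy [simp]: "copy_vec (uncopy_vec v) = v" "uncopy_vec (copy_vec w) = w"
  by (auto simp: copy_vec_def uncopy_vec_def vec_eq_iff Rep_ordered_copy_inverse Abs_ordered_copy_inverse)

lemma bij_Abs_ordered_copy: "bij (Abs_ordered_copy :: 'a \<Rightarrow> 'a ordered_copy)"
  by (rule bijI') (auto simp: Abs_ordered_copy_inject, metis Rep_ordered_copy_inverse)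

lemma card_ordered_copy: "CARD('a ordered_copy) = CARD('a)"
  by (metis bij_Abs_ordered_copy bij_betw_same_card)

lemma linear_copy_vec: "linear copy_vec" and linear_uncopy_vec: "linear uncopy_vec"
  by (auto intro!: linearI simp: copy_vec_def uncopy_vec_def vec_eq_iff)

lemma copy_vec_inner: "u \<bullet> copy_vec v = uncopy_vec u \<bullet> v"
proof -
  have "u \<bullet> copy_vec v = (\<Sum>i\<in>range Abs_ordered_copy. u $ i * v $ Rep_ordered_copy i)"
    using bij_Abs_ordered_copy[where 'a='a] by (simp add: inner_vec_def copy_vec_def bij_def)
  also have "\<dots> = uncopy_vec u \<bullet> v"
    using bij_Abs_ordered_copy[where 'a='a]
    by (subst sum.reindex) (auto simp: bij_def inner_vec_def uncopy_vec_def Abs_ordered_copy_inverse)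
  finally show ?thesis .
qed

text \<open>Relabelling coordinates takes boxes to boxes with the same side lengths, and Lebesgue
  measure is determined by its values on boxes.\<close>

lemma distr_copy_vec: "distr lborel borel copy_vec = (lborel :: (real ^ ('n::finite) ordered_copy) measure)"
proof (rule lborel_eqI[symmetric])
  fix l u :: "real ^ 'n ordered_copy"
  assume le: "\<And>b. b \<in> Basis \<Longrightarrow> l \<bullet> b \<le> u \<bullet> b"
  have le': "l $ i \<le> u $ i" for i
    using le[of "axis i 1"] by (simp add: inner_axis axis_in_Basis_iff)
  have prod_Basis: "(\<Prod>b\<in>Basis. v \<bullet> b) = (\<Prod>i\<in>UNIV. v $ i)" for v :: "real ^ 'm::finite"
  proof -
    have "(\<Prod>b\<in>Basis. v \<bullet> b) = (\<Prod>b\<in>range (\<lambda>i. axis i (1::real)). v \<bullet> b)"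
      by (rule prod.cong) (auto simp: Basis_vec_def)
    also have "\<dots> = (\<Prod>i\<in>UNIV. v $ i)"
      by (subst prod.reindex) (auto simp: inj_on_def axis_eq_axis inner_axis)
    finally show ?thesis .
  qed
  have vim: "copy_vec -` box l u = box (uncopy_vec l) (uncopy_vec u)"
  proof -
    have "(\<forall>i. P i) \<longleftrightarrow> (\<forall>i. P (Abs_ordered_copy i))" for P :: "'n ordered_copy \<Rightarrow> bool"
      by (metis Rep_ordered_copy_inverse)
    then show ?thesis
      unfolding vimage_def
      by (subst interval_cart, subst interval_cart)
        (simp add: copy_vec_def uncopy_vec_def Abs_ordered_copy_inverse)
  qed
  have meas: "copy_vec \<in> borel_measurable (borel :: (real ^ 'n) measure)"
    by (intro borel_measurable_continuous_onI linear_continuous_on linear_conv_bounded_linear[THEN iffD1] linear_copy_vec)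
  have "emeasure (distr lborel borel copy_vec) (box l u) = emeasure lborel (box (uncopy_vec l) (uncopy_vec u))"
    using meas by (subst emeasure_distr) (auto simp: vim)
  also have "\<dots> = (\<Prod>b\<in>Basis. (uncopy_vec u - uncopy_vec l) \<bullet> b)"
  proof (rule emeasure_lborel_box)
    fix b :: "real ^ 'n" assume "b \<in> Basis"
    then show "uncopy_vec l \<bullet> b \<le> uncopy_vec u \<bullet> b"
      using le' by (auto simp: Basis_vec_def inner_axis uncopy_vec_def)
  qed
  also have "(\<Prod>b\<in>Basis. (uncopy_vec u - uncopy_vec l) \<bullet> b) = (\<Prod>i\<in>range Abs_ordered_copy. (u - l) $ i)"
    using bij_Abs_ordered_copy[where 'a='n] unfolding prod_Basis
    by (subst prod.reindex) (auto simp: bij_def uncopy_vec_def)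
  also have "\<dots> = (\<Prod>b\<in>Basis. (u - l) \<bullet> b)"
    using bij_Abs_ordered_copy[where 'a='n] unfolding prod_Basis by (simp add: bij_def)
  finally show "emeasure (distr lborel borel copy_vec) (box l u) = (\<Prod>b\<in>Basis. (u - l) \<bullet> b)" .
qed simp

lemma content_copy_vec:
  assumes "S \<in> sets borel"
  shows "measure lborel (copy_vec -` S) = measure lborel S"
proof -
  have meas: "copy_vec \<in> borel_measurable (borel :: (real ^ 'n) measure)"
    by (intro borel_measurable_continuous_onI linear_continuous_on linear_conv_bounded_linear[THEN iffD1] linear_copy_vec)
  show ?thesis
    using assms meas by (subst distr_copy_vec[symmetric], subst measure_distr) auto
qed

text \<open>The well-ordered case is pulled back along \<open>copy_vec\<close>, which is linear and
  preserves volume; by \<open>copy_vec_inner\<close> its adjoint is \<open>uncopy_vec\<close>, which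
  carries the normal vector back.\<close>

lemma simplex_content_affine:
  fixes F :: "(real ^ 'n::finite) set"
  assumes fin: "finite F" and F: "card F = CARD('n)"
  shows "\<exists>\<nu> b. (\<forall>p\<in>F. \<nu> \<bullet> p = b) \<and>
    (\<forall>x. x \<notin> F \<longrightarrow> measure lborel (convex hull (insert x F)) = \<bar>\<nu> \<bullet> x - b\<bar>)"
proof -
  have inj: "inj (copy_vec :: real ^ 'n \<Rightarrow> _)"
    by (metis copy_uncopy(2) injI)
  have "card (copy_vec ` F) = CARD('n ordered_copy)"
    using F inj by (simp add: card_ordered_copy card_image inj_on_subset)
  then obtain \<nu> b where \<nu>: "\<And>p. p \<in> F \<Longrightarrow> \<nu> \<bullet> copy_vec p = b"
    and c: "\<And>x. x \<notin> copy_vec ` F \<Longrightarrow> measure lborel (convex hull (insert x (copy_vec ` F))) = \<bar>\<nu> \<bullet> x - b\<bar>"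
    using simplex_content_affine_wellorder[of "copy_vec ` F"] fin by blast
  have "measure lborel (convex hull (insert x F)) = \<bar>uncopy_vec \<nu> \<bullet> x - b\<bar>" if "x \<notin> F" for x
  proof -
    have "copy_vec ` (convex hull (insert x F)) = convex hull (insert (copy_vec x) (copy_vec ` F))"
      using convex_hull_linear_image[OF linear_copy_vec, of "insert x F"] by simp
    then have "convex hull (insert x F) = copy_vec -` (convex hull (insert (copy_vec x) (copy_vec ` F)))"
      by (metis inj inj_vimage_image_eq)
    moreover have "convex hull (insert (copy_vec x) (copy_vec ` F)) \<in> sets borel"
      using fin by (intro borel_compact finite_imp_compact_convex_hull) auto
    ultimately have "measure lborel (convex hull (insert x F)) = \<bar>\<nu> \<bullet> copy_vec x - b\<bar>"
      using that c[of "copy_vec x"] inj by (simp add: content_copy_vec inj_image_mem_iff)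
    then show ?thesis by (simp add: copy_vec_inner)
  qed
  with \<nu> show ?thesis
    by (intro exI[of _ "uncopy_vec \<nu>"] exI[of _ b]) (simp add: copy_vec_inner)
qed

text \<open>The hull has full affine dimension, hence an interior point, and a convex set with
  interior is not negligible.\<close>

lemma content_simplex_pos:
  fixes X :: "'a::euclidean_space set"
  assumes "\<not> affine_dependent X" "card X = DIM('a) + 1"
  shows "measure lborel (convex hull X) > 0"
proof -
  have fin: "finite X"
    using assms(1) aff_independent_finite by blast
  have "aff_dim (convex hull X) = int DIM('a)"
    using assms affine_independent_iff_card[of X] by (simp add: aff_dim_convex_hull)
  moreover have "X \<noteq> {}"
    using assms(2) by auto
  ultimately have "interior (convex hull X) \<noteq> {}"
    by (simp add: interior_rel_interior_gen rel_interior_eq_empty)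
  then have "\<not> negligible (convex hull X)"
    by (simp add: negligible_convex_interior)
  moreover have "convex hull X \<in> lmeasurable"
    using fin by (intro lmeasurable_compact finite_imp_compact_convex_hull)
  ultimately have "measure lebesgue (convex hull X) \<noteq> 0"
    by (simp add: negligible_iff_measure)
  moreover have "convex hull X \<in> sets borel"
    using fin by (intro borel_compact finite_imp_compact_convex_hull)
  ultimately show ?thesis
    by (simp add: measure_completion zero_less_measure_iff)
qed

subsection \<open>Points and lines in the plane\<close>

text \<open>Take the least value \<open>v\<close> of \<open>u\<close> whose lower level set has at
  least the proportion \<open>\<theta>\<close>. By minimality, at most that proportion lies strictly
  below \<open>v\<close>.\<close>

lemma quantile_exists:
  fixes u :: "'i \<Rightarrow> real"
    and \<theta> :: real
  assumes A: "finite A" "A \<noteq> {}" and \<theta>: "0 < \<theta>" "\<theta> \<le> 1"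
  shows "\<exists>v. \<theta> * card A \<le> card {a\<in>A. u a \<le> v} \<and> (1 - \<theta>) * card A \<le> card {a\<in>A. v \<le> u a}"
proof -
  define V where "V = {v\<in>u ` A. \<theta> * card A \<le> card {a\<in>A. u a \<le> v}}"
  have "{a\<in>A. u a \<le> Max (u ` A)} = A"
    using A by auto
  then have "\<theta> * card A \<le> card {a\<in>A. u a \<le> Max (u ` A)}"
    using \<theta> by (simp add: mult_left_le_one_le)
  moreover have "Max (u ` A) \<in> u ` A"
    using A by (intro Max_in) auto
  ultimately have "Max (u ` A) \<in> V"
    unfolding V_def by (intro CollectI conjI)
  then have V: "V \<noteq> {}" "finite V"
    using A by blast (simp add: V_def A)
  define v where "v = Min V"
  have "v \<in> V"
    using V by (simp add: v_def)
  have low: "card {a\<in>A. u a < v} \<le> \<theta> * card A"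
  proof (cases "{a\<in>A. u a < v} = {}")
    case False
    \<comment> \<open>The value of \<open>u\<close> just before \<open>v\<close>; it fails the
      condition defining \<open>V\<close>.\<close>
    define w where "w = Max (u ` {a\<in>A. u a < v})"
    have fin: "finite (u ` {a\<in>A. u a < v})" "u ` {a\<in>A. u a < v} \<noteq> {}"
      using A False by auto
    have "w \<in> u ` {a\<in>A. u a < v}"
      unfolding w_def using fin by (rule Max_in)
    then have w: "w < v" "w \<in> u ` A" by auto
    have "w \<notin> V"
      using w(1) V by (auto simp: v_def)
    then have "card {a\<in>A. u a \<le> w} < \<theta> * card A"
      using w(2) by (auto simp: V_def)
    moreover have "{a\<in>A. u a < v} \<subseteq> {a\<in>A. u a \<le> w}"
      using fin(1) by (auto simp: w_def)
    then have "card {a\<in>A. u a < v} \<le> card {a\<in>A. u a \<le> w}"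
      using A by (intro card_mono) auto
    ultimately show ?thesis by linarith
  next
    case True
    then show ?thesis
      using \<theta> by (simp only: card.empty) simp
  qed
  have "A = {a\<in>A. u a < v} \<union> {a\<in>A. v \<le> u a}" by auto
  then have "card A \<le> card {a\<in>A. u a < v} + card {a\<in>A. v \<le> u a}"
    by (metis (no_types, lifting) card_Un_le)
  then have "(1 - \<theta>) * card A \<le> card {a\<in>A. v \<le> u a}"
    using low by (simp add: algebra_simps flip: of_nat_add)
  then show ?thesis
    using \<open>v \<in> V\<close> by (auto simp: V_def)
qed

text \<open>The midpoint between \<open>v\<close> and the next larger value of \<open>u\<close>
  serves as the cut. It keeps the dividing lines clear of the points.\<close>

lemma gap_above:
  fixes u :: "'i \<Rightarrow> real"
  assumes "finite A"
  shows "\<exists>c. \<forall>a\<in>A. u a \<noteq> c \<and> (u a < c \<longleftrightarrow> u a \<le> v)"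
proof (cases "{a\<in>A. v < u a} = {}")
  case True
  then show ?thesis by (intro exI[of _ "v + 1"]) force
next
  case False
  define w where "w = Min (u ` {a\<in>A. v < u a})"
  have fin: "finite (u ` {a\<in>A. v < u a})" "u ` {a\<in>A. v < u a} \<noteq> {}"
    using assms False by auto
  then have "w \<in> u ` {a\<in>A. v < u a}"
    unfolding w_def by (rule Min_in)
  then have w: "v < w" by auto
  have le: "w \<le> u a" if "a \<in> A" "v < u a" for a
    using that fin(1) by (auto simp: w_def)
  show ?thesis
  proof (intro exI[of _ "(v + w) / 2"] ballI)
    fix a assume "a \<in> A"
    show "u a \<noteq> (v + w) / 2 \<and> (u a < (v + w) / 2 \<longleftrightarrow> u a \<le> v)"
      using w le[OF \<open>a \<in> A\<close>] by (cases "v < u a") auto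
  qed
qed

lemma card_split_le:
  fixes u :: "'i \<Rightarrow> real"
  assumes "finite A"
  shows "card {a\<in>A. v \<le> u a} \<le> card {a\<in>A. v < u a} + card {a\<in>A. u a = v}"
proof -
  have "{a\<in>A. v \<le> u a} = {a\<in>A. v < u a} \<union> {a\<in>A. u a = v}" by auto
  then show ?thesis by (metis (no_types, lifting) card_Un_le)
qed

section \<open>Cutting a planar point set into four large quadrants\<close>

definition few_on_lines :: "real \<Rightarrow> 'i set \<Rightarrow> ('i \<Rightarrow> real) \<Rightarrow> ('i \<Rightarrow> real) \<Rightarrow> bool" where
  "few_on_lines \<eta> I X Y \<longleftrightarrow>
    (\<forall>p q r. (p, q) \<noteq> (0, 0) \<longrightarrow> real (card {i\<in>I. p * X i + q * Y i = r}) \<le> \<eta> * real (card I))"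

lemma few_on_linesD:
  "few_on_lines \<eta> I X Y \<Longrightarrow> p \<noteq> 0 \<or> q \<noteq> 0 \<Longrightarrow> real (card {i\<in>I. p * X i + q * Y i = r}) \<le> \<eta> * real (card I)"
  by (auto simp: few_on_lines_def)

text \<open>With \<open>s\<close> and \<open>t\<close> equal to 1 or -1, this is one of the four
  open regions cut out by the lines \<open>Z = 0\<close> and \<open>U = 0\<close>.\<close>

definition quadrant :: "'i set \<Rightarrow> ('i \<Rightarrow> real) \<Rightarrow> ('i \<Rightarrow> real) \<Rightarrow> real \<Rightarrow> real \<Rightarrow> 'i set" where
  "quadrant I Z U s t = {i\<in>I. 0 < s * Z i \<and> 0 < t * U i}"

text \<open>If the upper quartile of \<open>g\<close> on \<open>B\<close> were below the lower quartile of \<open>f\<close> on \<open>A\<close>, at least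
  9/16 of the pairs would satisfy \<open>g b < f a\<close>.\<close>
lemma quartiles_interleave:
  fixes f :: "'a \<Rightarrow> real" and g :: "'b \<Rightarrow> real"
  assumes fin: "finite A" "finite B" and ne: "A \<noteq> {}" "B \<noteq> {}"
    and half: "1 / 2 * (card A * card B) \<le> card {(a, b)\<in>A \<times> B. f a \<le> g b}"
    and lo: "3 / 4 * card A \<le> card {a\<in>A. lo \<le> f a}"
    and hi: "3 / 4 * card B \<le> card {b\<in>B. g b \<le> hi}"
  shows "lo \<le> hi"
proof (rule ccontr)
  assume "\<not> lo \<le> hi"
  then have disj: "{a\<in>A. lo \<le> f a} \<times> {b\<in>B. g b \<le> hi} \<inter> {(a, b)\<in>A \<times> B. f a \<le> g b} = {}"
    by auto
  have "card ({a\<in>A. lo \<le> f a} \<times> {b\<in>B. g b \<le> hi}) + card {(a, b)\<in>A \<times> B. f a \<le> g b}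
      = card ({a\<in>A. lo \<le> f a} \<times> {b\<in>B. g b \<le> hi} \<union> {(a, b)\<in>A \<times> B. f a \<le> g b})"
    using fin disj by (intro card_Un_disjoint[symmetric]) (auto intro: finite_subset[of _ "A \<times> B"])
  also have "\<dots> \<le> card (A \<times> B)"
    using fin by (intro card_mono) auto
  finally have "real (card {a\<in>A. lo \<le> f a}) * card {b\<in>B. g b \<le> hi}
      + card {(a, b)\<in>A \<times> B. f a \<le> g b} \<le> real (card A) * card B"
    by (simp add: card_cartesian_product flip: of_nat_mult of_nat_add)
  moreover have "(3 / 4 * card A) * (3 / 4 * card B) \<le> real (card {a\<in>A. lo \<le> f a}) * card {b\<in>B. g b \<le> hi}"
    using lo hi by (intro mult_mono) auto
  moreover have "0 < real (card A) * card B"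
    using fin ne by (simp add: card_gt_0_iff)
  ultimately show False
    using half by simp
qed

text \<open>Two subsets with three quarters of the elements each must meet.\<close>

lemma card_quartiles_le:
  fixes u :: "'i \<Rightarrow> real"
  assumes "finite A" "A \<noteq> {}" "3 / 4 * card A \<le> card {a\<in>A. lo \<le> u a}" "3 / 4 * card A \<le> card {a\<in>A. u a \<le> hi}"
  shows "lo \<le> hi"
proof (rule ccontr)
  assume "\<not> lo \<le> hi"
  then have "{a\<in>A. lo \<le> u a} \<inter> {a\<in>A. u a \<le> hi} = {}" by auto
  then have "card {a\<in>A. lo \<le> u a} + card {a\<in>A. u a \<le> hi} = card ({a\<in>A. lo \<le> u a} \<union> {a\<in>A. u a \<le> hi})"
    using assms(1) by (intro card_Un_disjoint[symmetric]) auto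
  also have "\<dots> \<le> card A"
    using assms(1) by (intro card_mono) auto
  finally have "real (card {a\<in>A. lo \<le> u a}) + card {a\<in>A. u a \<le> hi} \<le> card A"
    by (simp flip: of_nat_add)
  moreover have "0 < card A"
    using assms(1,2) by (simp add: card_gt_0_iff)
  ultimately show False using assms(3,4) by simp
qed

text \<open>A vertical line separates a left part \<open>A\<close> from a right part
  \<open>B\<close>. The second line gets the median slope of the segments from \<open>A\<close> to
  \<open>B\<close>: seen along that direction, the middle halves of \<open>A\<close> and
  \<open>B\<close> overlap, so one level cuts both parts well.\<close>

lemma quadrants:
  fixes X Y :: "'i \<Rightarrow> real"
  assumes I: "finite I" "I \<noteq> {}" and few: "few_on_lines (1 / 64) I X Y"
  shows "\<exists>x0 t c. (\<forall>i\<in>I. X i \<noteq> x0 \<and> Y i - t * X i \<noteq> c) \<and>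
    (\<forall>\<sigma>\<in>{1,-1}. \<forall>\<tau>\<in>{1,-1}. card I / 32 \<le>
      card (quadrant I (\<lambda>i. X i - x0) (\<lambda>i. Y i - t * X i - c) \<sigma> \<tau>))"
proof -
  let ?n = "real (card I)"
  have n: "0 < ?n"
    using I by (simp add: card_gt_0_iff)
  obtain v where v: "1 / 4 * ?n \<le> card {i\<in>I. X i \<le> v}" "3 / 4 * ?n \<le> card {i\<in>I. v \<le> X i}"
    using quantile_exists[OF I, of "1/4" X] by auto
  obtain x0 where x0: "\<And>i. i \<in> I \<Longrightarrow> X i \<noteq> x0" "\<And>i. i \<in> I \<Longrightarrow> X i < x0 \<longleftrightarrow> X i \<le> v"
    using gap_above[OF I(1), of X v] by metis
  define A where "A = {i\<in>I. X i < x0}"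
  define B where "B = {i\<in>I. x0 < X i}"
  have A: "?n / 4 \<le> card A"
  proof -
    have "A = {i\<in>I. X i \<le> v}"
      using x0 by (auto simp: A_def)
    then show ?thesis using v by simp
  qed
  have B: "?n / 4 \<le> card B"
  proof -
    have "B = {i\<in>I. v < X i}"
      using x0 by (force simp: B_def not_less not_le)
    then have "card B = card {i\<in>I. v < X i}"
      by simp
    \<comment> \<open>The upper set may lose the points on the line \<open>X = v\<close>, at most
      1/64 of all, and 3/4 - 1/64 still exceeds 1/4.\<close>
    moreover have "card {i\<in>I. X i = v} \<le> 1 / 64 * ?n"
      using few_on_linesD[OF few, of 1 0 v] by simp
    ultimately show ?thesis
      using v(2) card_split_le[OF I(1), of v X] by linarith
  qed
  have fin: "finite A" "finite B"
    using I by (auto simp: A_def B_def)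
  have "0 < real (card A)" "0 < real (card B)"
    using A B n by linarith+
  then have ne: "A \<noteq> {}" "B \<noteq> {}"
    by auto
  define slope where "slope = (\<lambda>(a, b). (Y b - Y a) / (X b - X a))"
  obtain t where t: "1 / 2 * card (A \<times> B) \<le> card {z\<in>A \<times> B. slope z \<le> t}"
      "1 / 2 * card (A \<times> B) \<le> card {z\<in>A \<times> B. t \<le> slope z}"
    using quantile_exists[of "A \<times> B" "1/2" slope] fin ne by auto
  \<comment> \<open>The intercept of the line of slope \<open>t\<close> through the point
    \<open>i\<close>. Since \<open>t\<close> is a median slope, at least half of the pairs from
    \<open>A\<close> and \<open>B\<close> have \<open>u a \<le> u b\<close>, and at least half have
    the reverse.\<close>
  define u where "u i = Y i - t * X i" for i
  have slope: "slope (a, b) \<le> t \<longleftrightarrow> u b \<le> u a" "t \<le> slope (a, b) \<longleftrightarrow> u a \<le> u b"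
    if "a \<in> A" "b \<in> B" for a b
  proof -
    have "X a < X b"
      using that by (auto simp: A_def B_def)
    then show "slope (a, b) \<le> t \<longleftrightarrow> u b \<le> u a" "t \<le> slope (a, b) \<longleftrightarrow> u a \<le> u b"
      by (auto simp: slope_def u_def field_simps)
  qed
  have "{z\<in>A \<times> B. t \<le> slope z} = {(a, b)\<in>A \<times> B. u a \<le> u b}"
    using slope by auto
  then have AB: "1 / 2 * (card A * card B) \<le> card {(a, b)\<in>A \<times> B. u a \<le> u b}"
    using t by (simp add: card_cartesian_product)
  have "{z\<in>A \<times> B. slope z \<le> t} = prod.swap ` {(b, a)\<in>B \<times> A. u b \<le> u a}"
    using slope by force
  then have BA: "1 / 2 * (card B * card A) \<le> card {(b, a)\<in>B \<times> A. u b \<le> u a}"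
    using t by (simp add: card_cartesian_product card_image mult.commute)
  obtain a_lo where a_lo: "1 / 4 * card A \<le> card {a\<in>A. u a \<le> a_lo}" "3 / 4 * card A \<le> card {a\<in>A. a_lo \<le> u a}"
    using quantile_exists[of A "1/4" u] fin ne by auto
  obtain a_hi where a_hi: "3 / 4 * card A \<le> card {a\<in>A. u a \<le> a_hi}" "1 / 4 * card A \<le> card {a\<in>A. a_hi \<le> u a}"
    using quantile_exists[of A "3/4" u] fin ne by auto
  obtain b_lo where b_lo: "1 / 4 * card B \<le> card {a\<in>B. u a \<le> b_lo}" "3 / 4 * card B \<le> card {a\<in>B. b_lo \<le> u a}"
    using quantile_exists[of B "1/4" u] fin ne by auto
  obtain b_hi where b_hi: "3 / 4 * card B \<le> card {a\<in>B. u a \<le> b_hi}" "1 / 4 * card B \<le> card {a\<in>B. b_hi \<le> u a}"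
    using quantile_exists[of B "3/4" u] fin ne by auto
  have "a_lo \<le> b_hi" "b_lo \<le> a_hi" "a_lo \<le> a_hi" "b_lo \<le> b_hi"
    using quartiles_interleave[OF fin ne AB a_lo(2) b_hi(1)]
      quartiles_interleave[OF fin(2,1) ne(2,1) BA b_lo(2) a_hi(1)]
      card_quartiles_le[OF fin(1) ne(1) a_lo(2) a_hi(1)]
      card_quartiles_le[OF fin(2) ne(2) b_lo(2) b_hi(1)] by auto
  \<comment> \<open>This level lies between the lower and upper quartiles of both \<open>A\<close>
    and \<open>B\<close>.\<close>
  define c1 where "c1 = max a_lo b_lo"
  have c1: "a_lo \<le> c1" "b_lo \<le> c1" "c1 \<le> a_hi" "c1 \<le> b_hi"
    using \<open>a_lo \<le> b_hi\<close> \<open>b_lo \<le> a_hi\<close> \<open>a_lo \<le> a_hi\<close> \<open>b_lo \<le> b_hi\<close> by (auto simp: c1_def)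
  obtain c where c: "\<And>i. i \<in> I \<Longrightarrow> u i \<noteq> c" "\<And>i. i \<in> I \<Longrightarrow> u i < c \<longleftrightarrow> u i \<le> c1"
    using gap_above[OF I(1), of u c1] by metis
  have parts: "card I / 32 \<le> card {i\<in>S. u i < c}" "card I / 32 \<le> card {i\<in>S. c < u i}"
    if S: "S \<subseteq> I" "?n / 4 \<le> card S" and lo: "1 / 4 * card S \<le> card {a\<in>S. u a \<le> lo}" "lo \<le> c1"
      and hi: "1 / 4 * card S \<le> card {a\<in>S. hi \<le> u a}" "c1 \<le> hi" for S lo hi
  proof -
    have finS: "finite S"
      using S(1) I(1) finite_subset by blast
    have "{a\<in>S. u a \<le> lo} \<subseteq> {i\<in>S. u i < c}"
      using c(2) S lo(2) by auto
    then have "card {a\<in>S. u a \<le> lo} \<le> card {i\<in>S. u i < c}"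
      using finS by (intro card_mono) auto
    then show "card I / 32 \<le> card {i\<in>S. u i < c}"
      using lo(1) S(2) n by linarith
    \<comment> \<open>The points at level \<open>c1\<close> fall below the cut \<open>c\<close>.
      They lie on one line, so the upper side keeps at least the proportion 1/16 - 1/64, which is
      more than 1/32.\<close>
    have "card {a\<in>S. u a = c1} \<le> card {i\<in>I. (-t) * X i + 1 * Y i = c1}"
      using S I by (intro card_mono) (auto simp: u_def)
    also have "\<dots> \<le> 1 / 64 * ?n"
      by (rule few_on_linesD[OF few]) simp
    finally have "card {a\<in>S. u a = c1} \<le> 1 / 64 * ?n"
      by simp
    moreover have "card {a\<in>S. hi \<le> u a} \<le> card {a\<in>S. c1 \<le> u a}"
      using finS hi(2) by (intro card_mono) auto
    moreover have "{i\<in>S. c < u i} = {i\<in>S. c1 < u i}"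
      using c S by (force simp: not_less not_le)
    then have "card {i\<in>S. c < u i} = card {i\<in>S. c1 < u i}"
      by simp
    ultimately show "card I / 32 \<le> card {i\<in>S. c < u i}"
      using hi(1) S(2) card_split_le[OF finS, of c1 u] n by linarith
  qed
  have partsA: "card I / 32 \<le> card {i\<in>A. u i < c}" "card I / 32 \<le> card {i\<in>A. c < u i}"
    using parts[OF _ A a_lo(1) c1(1) a_hi(2) c1(3)] by (auto simp: A_def)
  have partsB: "card I / 32 \<le> card {i\<in>B. u i < c}" "card I / 32 \<le> card {i\<in>B. c < u i}"
    using parts[OF _ B b_lo(1) c1(2) b_hi(2) c1(4)] by (auto simp: B_def)
  have "quadrant I (\<lambda>i. X i - x0) (\<lambda>i. Y i - t * X i - c) (-1) (-1) = {i\<in>A. u i < c}"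
       "quadrant I (\<lambda>i. X i - x0) (\<lambda>i. Y i - t * X i - c) (-1) 1 = {i\<in>A. c < u i}"
       "quadrant I (\<lambda>i. X i - x0) (\<lambda>i. Y i - t * X i - c) 1 (-1) = {i\<in>B. u i < c}"
       "quadrant I (\<lambda>i. X i - x0) (\<lambda>i. Y i - t * X i - c) 1 1 = {i\<in>B. c < u i}"
    by (auto simp: quadrant_def A_def B_def u_def)
  then show ?thesis
    using partsA partsB x0(1) c(1)
    by (intro exI[of _ x0] exI[of _ t] exI[of _ c]) (auto simp: u_def)
qed

lemma line_avoids_quadrant:
  fixes p q r :: real
  assumes "p \<noteq> 0 \<or> q \<noteq> 0"
  shows "\<exists>\<sigma>\<in>{1,-1}. \<exists>\<tau>\<in>{1,-1}. \<forall>z w. 0 < \<sigma> * z \<longrightarrow> 0 < \<tau> * w \<longrightarrow> p * z + q * w \<noteq> r"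
proof -
  \<comment> \<open>Choose the signs so that \<open>p * z + q * w\<close> has strictly the opposite sign of \<open>r\<close>.\<close>
  define e :: real where "e = (if 0 \<le> r then 1 else -1)"
  define \<sigma> :: real where "\<sigma> = (if 0 \<le> e * p then -1 else 1)"
  define \<tau> :: real where "\<tau> = (if 0 \<le> e * q then -1 else 1)"
  have "p * z + q * w \<noteq> r" if "0 < \<sigma> * z" "0 < \<tau> * w" for z w
  proof -
    have "e * p * z \<le> 0" "e * q * w \<le> 0" "p \<noteq> 0 \<Longrightarrow> e * p * z < 0" "q \<noteq> 0 \<Longrightarrow> e * q * w < 0"
      using that by (auto simp: \<sigma>_def \<tau>_def e_def mult_le_0_iff mult_less_0_iff split: if_splits)
    then have "e * (p * z + q * w) < 0"
      using assms by (auto simp: algebra_simps)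
    then show ?thesis
      by (auto simp: e_def split: if_splits)
  qed
  moreover have "\<sigma> \<in> {1,-1}" "\<tau> \<in> {1,-1}"
    by (auto simp: \<sigma>_def \<tau>_def)
  ultimately show ?thesis by blast
qed

text \<open>The four quadrants form the partition. The shear and translation to the coordinates
  \<open>X - x0\<close> and \<open>Y - t * X - c\<close> turn lines into lines, and every line
  misses some open quadrant.\<close>

lemma line_avoiding_partition:
  fixes X Y :: "'i \<Rightarrow> real"
  assumes I: "finite I" "I \<noteq> {}" and few: "few_on_lines (1 / 64) I X Y"
  shows "\<exists>\<P>. finite \<P> \<and> disjoint \<P> \<and> \<Union>\<P> = I \<and> (\<forall>J\<in>\<P>. card I / 32 \<le> card J) \<and>
    (\<forall>p q r. p \<noteq> 0 \<or> q \<noteq> 0 \<longrightarrow> (\<exists>J\<in>\<P>. \<forall>i\<in>J. p * X i + q * Y i \<noteq> r))"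
proof -
  obtain x0 t c where off: "\<And>i. i \<in> I \<Longrightarrow> X i \<noteq> x0 \<and> Y i - t * X i \<noteq> c"
    and large: "\<And>\<sigma> \<tau>. \<sigma> \<in> {1,-1} \<Longrightarrow> \<tau> \<in> {1,-1} \<Longrightarrow>
      card I / 32 \<le> card (quadrant I (\<lambda>i. X i - x0) (\<lambda>i. Y i - t * X i - c) \<sigma> \<tau>)"
    using quadrants[OF assms] by blast
  define Q where "Q = (\<lambda>(\<sigma>, \<tau>). quadrant I (\<lambda>i. X i - x0) (\<lambda>i. Y i - t * X i - c) \<sigma> \<tau>)"
  define \<P> where "\<P> = Q ` ({1,-1} \<times> {1,-1})"
  have "finite \<P>" by (simp add: \<P>_def)
  moreover have "disjoint \<P>"
    by (auto simp: \<P>_def Q_def disjoint_def quadrant_def)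
  moreover have "\<Union>\<P> = I"
  proof
    show "I \<subseteq> \<Union>\<P>"
    proof
      fix i assume i: "i \<in> I"
      have "i \<in> Q (if x0 < X i then 1 else -1, if c < Y i - t * X i then 1 else -1)"
        using i off[OF i] by (auto simp: Q_def quadrant_def)
      then show "i \<in> \<Union>\<P>"
        unfolding \<P>_def by (rule UN_I[rotated]) auto
    qed
  qed (auto simp: \<P>_def Q_def quadrant_def)
  moreover have "\<forall>J\<in>\<P>. card I / 32 \<le> card J"
    using large by (auto simp: \<P>_def Q_def)
  moreover have "\<exists>J\<in>\<P>. \<forall>i\<in>J. p * X i + q * Y i \<noteq> r" if "p \<noteq> 0 \<or> q \<noteq> 0" for p q r
  proof -
    \<comment> \<open>These are the coefficients of the line in the sheared coordinates.\<close>
    have "p + q * t \<noteq> 0 \<or> q \<noteq> 0"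
      using that by auto
    then obtain \<sigma> \<tau> where st: "\<sigma> \<in> {1,-1}" "\<tau> \<in> {1,-1}"
      and avoid: "\<And>z w. 0 < \<sigma> * z \<Longrightarrow> 0 < \<tau> * w \<Longrightarrow>
        (p + q * t) * z + q * w \<noteq> r - (p + q * t) * x0 - q * c"
      using line_avoids_quadrant[of "p + q * t" q "r - (p + q * t) * x0 - q * c"] by blast
    have "p * X i + q * Y i \<noteq> r" if "i \<in> Q (\<sigma>, \<tau>)" for i
      using avoid[of "X i - x0" "Y i - t * X i - c"] that
      by (auto simp: Q_def quadrant_def algebra_simps)
    then show ?thesis
      using st unfolding \<P>_def by blast
  qed
  ultimately show ?thesis by blast
qed

section \<open>Point-line incidences and a weak Beck theorem\<close>

definition on_line :: "'i set \<Rightarrow> ('i \<Rightarrow> real) \<Rightarrow> ('i \<Rightarrow> real) \<Rightarrow> bool" where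
  "on_line J X Y \<longleftrightarrow> (\<exists>p q r. (p \<noteq> 0 \<or> q \<noteq> 0) \<and> (\<forall>i\<in>J. p * X i + q * Y i = r))"

text \<open>The members of \<open>\<L>\<close> play the role of lines; only their traces on \<open>I\<close> matter.\<close>
definition line_family :: "'i set \<Rightarrow> ('i \<Rightarrow> real) \<Rightarrow> ('i \<Rightarrow> real) \<Rightarrow> 'i set set \<Rightarrow> bool" where
  "line_family I X Y \<L> \<longleftrightarrow> finite \<L> \<and> (\<forall>l\<in>\<L>. on_line (l \<inter> I) X Y) \<and>
    (\<forall>l\<in>\<L>. \<forall>l'\<in>\<L>. l \<noteq> l' \<longrightarrow> card (l \<inter> l' \<inter> I) \<le> 1)"

lemma line_family_mono:
  assumes "line_family I X Y \<L>" "finite I" "J \<subseteq> I" "\<K> \<subseteq> \<L>"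
  shows "line_family J X Y \<K>"
proof -
  have "card (l \<inter> l' \<inter> J) \<le> card (l \<inter> l' \<inter> I)" for l l'
    using assms by (intro card_mono) auto
  moreover have "on_line (l \<inter> J) X Y" if "on_line (l \<inter> I) X Y" for l
    using that assms unfolding on_line_def by blast
  moreover have "finite \<K>"
    using assms finite_subset by (auto simp: line_family_def)
  ultimately show ?thesis
    using assms unfolding line_family_def by (meson le_trans subsetD)
qed

lemma few_on_lines_mono:
  fixes \<eta> \<eta>' :: real
  assumes "few_on_lines \<eta> I X Y" "finite I" "J \<subseteq> I" "\<eta> * card I \<le> \<eta>' * card J"
  shows "few_on_lines \<eta>' J X Y"
  unfolding few_on_lines_def
proof (intro allI impI)
  fix p q r :: real assume "(p, q) \<noteq> (0, 0)"
  then have "card {i\<in>I. p * X i + q * Y i = r} \<le> \<eta> * card I"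
    using assms(1) by (auto simp: few_on_lines_def)
  moreover have "card {i\<in>J. p * X i + q * Y i = r} \<le> card {i\<in>I. p * X i + q * Y i = r}"
    using assms by (intro card_mono) auto
  ultimately show "card {i\<in>J. p * X i + q * Y i = r} \<le> \<eta>' * card J"
    using assms(4) by linarith
qed

lemma card_offdiag:
  assumes "finite A"
  shows "real (card (A \<times> A - Id)) = (real (card A))\<^sup>2 - card A"
proof -
  have "A \<times> A - Id = A \<times> A - (\<lambda>x. (x, x)) ` A"
    by auto
  then have "card (A \<times> A - Id) = card (A \<times> A) - card ((\<lambda>x. (x, x)) ` A)"
    using assms by (simp only:) (rule card_Diff_subset, auto)
  also have "card ((\<lambda>x. (x, x)) ` A) = card A"
    by (simp add: card_image inj_on_def)
  finally show ?thesis
    using assms by (simp add: card_cartesian_product power2_eq_square of_nat_diff)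
qed

text \<open>An ordered pair of distinct points lies on at most one member of \<open>\<L>\<close>, so
  the sets being counted are disjoint.\<close>

lemma sum_card_offdiag:
  assumes "finite I" "line_family I X Y \<L>"
  shows "(\<Sum>l\<in>\<L>. card ((l \<inter> I) \<times> (l \<inter> I) - Id)) = card (\<Union>l\<in>\<L>. (l \<inter> I) \<times> (l \<inter> I) - Id)"
proof (rule card_UN_disjoint[symmetric])
  show "\<forall>l\<in>\<L>. \<forall>l'\<in>\<L>. l \<noteq> l' \<longrightarrow>
      ((l \<inter> I) \<times> (l \<inter> I) - Id) \<inter> ((l' \<inter> I) \<times> (l' \<inter> I) - Id) = {}"
  proof (intro ballI impI)
    fix l l' assume l: "l \<in> \<L>" "l' \<in> \<L>" "l \<noteq> l'"
    then have "card (l \<inter> l' \<inter> I) \<le> 1"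
      using assms by (auto simp: line_family_def)
    then have "x = y" if "x \<in> l \<inter> l' \<inter> I" "y \<in> l \<inter> l' \<inter> I" for x y
      using that assms(1) card_le_Suc0_iff_eq[of "l \<inter> l' \<inter> I"] by auto
    then show "((l \<inter> I) \<times> (l \<inter> I) - Id) \<inter> ((l' \<inter> I) \<times> (l' \<inter> I) - Id) = {}"
      by auto
  qed
qed (use assms in \<open>auto simp: line_family_def\<close>)

text \<open>Counting pairs of distinct points; this is the case without any gain, from which the
  recursion starts.\<close>

lemma line_family_sum_squares:
  assumes "finite I" "line_family I X Y \<L>"
  shows "(\<Sum>l\<in>\<L>. (real (card (l \<inter> I)))\<^sup>2) \<le> (real (card I))\<^sup>2 + (\<Sum>l\<in>\<L>. real (card (l \<inter> I)))"
proof -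
  have "(\<Sum>l\<in>\<L>. (real (card (l \<inter> I)))\<^sup>2) - (\<Sum>l\<in>\<L>. real (card (l \<inter> I)))
      = (\<Sum>l\<in>\<L>. real (card ((l \<inter> I) \<times> (l \<inter> I) - Id)))"
    using assms(1) by (simp add: card_offdiag sum_subtractf)
  also have "\<dots> = real (card (\<Union>l\<in>\<L>. (l \<inter> I) \<times> (l \<inter> I) - Id))"
    using sum_card_offdiag[OF assms] by (simp flip: of_nat_sum)
  also have "\<dots> \<le> card (I \<times> I)"
    using assms(1) by (intro of_nat_mono card_mono) auto
  finally show ?thesis
    by (simp add: card_cartesian_product power2_eq_square)
qed

text \<open>A line misses one part of the partition, so the weighted Cauchy--Schwarz inequality gains the
  factor 31/32 at every level of the recursion.\<close>
lemma line_square_sum_decay: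
  "\<exists>\<eta>>0. \<exists>K\<ge>0. \<forall>(I :: 'i set) X Y \<L>. finite I \<longrightarrow> few_on_lines \<eta> I X Y \<longrightarrow> line_family I X Y \<L> \<longrightarrow>
    (\<Sum>l\<in>\<L>. (real (card (l \<inter> I)))\<^sup>2)
      \<le> (31 / 32) ^ j * (real (card I))\<^sup>2 + K * (\<Sum>l\<in>\<L>. real (card (l \<inter> I)))"
proof (induction j)
  case 0
  show ?case
    using line_family_sum_squares by (intro exI[of _ 1]) (auto intro!: exI[of _ 1])
next
  case (Suc j)
  then obtain \<eta> K :: real where \<eta>: "\<eta> > 0" and K: "K \<ge> 0"
    and IH: "\<And>(I :: 'i set) X Y \<L>. finite I \<Longrightarrow> few_on_lines \<eta> I X Y \<Longrightarrow> line_family I X Y \<L> \<Longrightarrow>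
      (\<Sum>l\<in>\<L>. (real (card (l \<inter> I)))\<^sup>2)
        \<le> (31 / 32) ^ j * (real (card I))\<^sup>2 + K * (\<Sum>l\<in>\<L>. real (card (l \<inter> I)))"
    by blast
  \<comment> \<open>The bound 1/64 permits the partition. As each part has at least 1/32 of the
    points, \<open>\<eta> / 32\<close> on the whole becomes \<open>\<eta>\<close> on each
    part.\<close>
  define \<eta>' where "\<eta>' = min (\<eta> / 32) (1 / 64)"
  have "\<eta>' > 0"
    using \<eta> by (simp add: \<eta>'_def)
  have main: "(\<Sum>l\<in>\<L>. (real (card (l \<inter> I)))\<^sup>2)
      \<le> (31 / 32) ^ Suc j * (real (card I))\<^sup>2 + 32 * K * (\<Sum>l\<in>\<L>. real (card (l \<inter> I)))"
    if I: "finite I" and few: "few_on_lines \<eta>' I X Y" and \<L>: "line_family I X Y \<L>"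
    for I :: "'i set" and X Y \<L>
  proof (cases "I = {}")
    case False
    define n where "n = real (card I)"
    have n: "n > 0"
      using I False by (simp add: n_def card_gt_0_iff)
    have "\<eta>' * n \<le> 1 / 64 * n"
      using n by (intro mult_right_mono) (auto simp: \<eta>'_def)
    then have few64: "few_on_lines (1 / 64) I X Y"
      using few_on_lines_mono[OF few I] by (simp add: n_def)
    obtain \<P> where "finite \<P> \<and> disjoint \<P> \<and> \<Union>\<P> = I \<and> (\<forall>J\<in>\<P>. n / 32 \<le> card J) \<and>
        (\<forall>p q r. p \<noteq> 0 \<or> q \<noteq> 0 \<longrightarrow> (\<exists>J\<in>\<P>. \<forall>i\<in>J. p * X i + q * Y i \<noteq> r))"
      using line_avoiding_partition[OF I False few64] unfolding n_def by (rule exE)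
    then have \<P>: "finite \<P>" "disjoint \<P>" "\<Union>\<P> = I"
      and large: "\<And>J. J \<in> \<P> \<Longrightarrow> n / 32 \<le> card J"
      and avoid: "\<And>p q r. p \<noteq> 0 \<or> q \<noteq> 0 \<Longrightarrow> \<exists>J\<in>\<P>. \<forall>i\<in>J. p * X i + q * Y i \<noteq> r"
      by simp_all
    have sub: "J \<subseteq> I" "finite J" if "J \<in> \<P>" for J
      using that \<P>(3) I by (auto intro: finite_subset)
    \<comment> \<open>These weights sum to 1 and are at least 1/32.\<close>
    define w where "w J = real (card J) / n" for J :: "'i set"
    have w: "w J \<ge> 1 / 32" "w J > 0" "w J \<ge> 0" if "J \<in> \<P>" for J
      using large[OF that] n by (auto simp: w_def field_simps)
    have card_trace: "card (l \<inter> I) = (\<Sum>J\<in>\<P>. card (l \<inter> J))" for l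
    proof -
      have "card (\<Union>J\<in>\<P>. l \<inter> J) = (\<Sum>J\<in>\<P>. card (l \<inter> J))"
      proof (rule card_UN_disjoint)
        show "\<forall>J\<in>\<P>. \<forall>J'\<in>\<P>. J \<noteq> J' \<longrightarrow> (l \<inter> J) \<inter> (l \<inter> J') = {}"
          using \<P>(2) by (auto dest: disjointD)
      qed (use \<P> sub in auto)
      moreover have "(\<Union>J\<in>\<P>. l \<inter> J) = l \<inter> I"
        using \<P>(3) by auto
      ultimately show ?thesis by simp
    qed
    have wsum: "(\<Sum>J\<in>\<P>. w J) = 1"
      using card_trace[of UNIV] n by (simp add: w_def n_def flip: sum_divide_distrib of_nat_sum)
    \<comment> \<open>The part missed by \<open>l\<close> can be left out of the sum, so the weights
      in the Cauchy-Schwarz factor add up to at most 31/32.\<close>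
    have split: "(real (card (l \<inter> I)))\<^sup>2 \<le> 31 / 32 * (\<Sum>J\<in>\<P>. (real (card (l \<inter> J)))\<^sup>2 / w J)"
      if l: "l \<in> \<L>" for l
    proof -
      obtain p q r where "p \<noteq> 0 \<or> q \<noteq> 0" and on: "\<And>i. i \<in> l \<inter> I \<Longrightarrow> p * X i + q * Y i = r"
        using \<L> l unfolding line_family_def on_line_def by meson
      then obtain J0 where J0: "J0 \<in> \<P>" "\<And>i. i \<in> J0 \<Longrightarrow> p * X i + q * Y i \<noteq> r"
        using avoid by meson
      then have "l \<inter> J0 = {}"
        using on sub by blast
      then have "real (card (l \<inter> I)) = (\<Sum>J\<in>\<P> - {J0}. real (card (l \<inter> J)))"
        using \<P>(1) J0(1) by (simp add: card_trace sum.remove[of \<P> J0])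
      also have "\<dots> = (\<Sum>J\<in>\<P> - {J0}. sqrt (w J) * (card (l \<inter> J) / sqrt (w J)))"
      proof (rule sum.cong)
        fix J assume "J \<in> \<P> - {J0}"
        then show "real (card (l \<inter> J)) = sqrt (w J) * (card (l \<inter> J) / sqrt (w J))"
          using w(2)[of J] by simp
      qed simp
      finally have "(real (card (l \<inter> I)))\<^sup>2
          \<le> (\<Sum>J\<in>\<P> - {J0}. (sqrt (w J))\<^sup>2) * (\<Sum>J\<in>\<P> - {J0}. (card (l \<inter> J) / sqrt (w J))\<^sup>2)"
        using Cauchy_Schwarz_ineq_sum by metis
      also have "(\<Sum>J\<in>\<P> - {J0}. (sqrt (w J))\<^sup>2) = (\<Sum>J\<in>\<P> - {J0}. w J)"
        using w(3) by (intro sum.cong) simp_all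
      also have "\<dots> = 1 - w J0"
        using wsum \<P>(1) J0(1) by (simp add: sum.remove[of \<P> J0])
      also have "(\<Sum>J\<in>\<P> - {J0}. (card (l \<inter> J) / sqrt (w J))\<^sup>2) = (\<Sum>J\<in>\<P> - {J0}. (real (card (l \<inter> J)))\<^sup>2 / w J)"
        using w(3) by (intro sum.cong) (simp_all add: power_divide)
      also have "\<dots> = (\<Sum>J\<in>\<P>. (real (card (l \<inter> J)))\<^sup>2 / w J)"
        using \<P>(1) J0(1) \<open>l \<inter> J0 = {}\<close> by (simp add: sum.remove[of \<P> J0])
      also have "(1 - w J0) * \<dots> \<le> 31 / 32 * \<dots>"
      proof (rule mult_right_mono)
        show "0 \<le> (\<Sum>J\<in>\<P>. (real (card (l \<inter> J)))\<^sup>2 / w J)"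
          using w(2) by (intro sum_nonneg divide_nonneg_pos) auto
      qed (use w(1)[OF J0(1)] in simp)
      finally show ?thesis .
    qed
    \<comment> \<open>The induction hypothesis inside \<open>J\<close>, divided by
      \<open>w J\<close>: the square of \<open>card J\<close> becomes n^2 times \<open>w J\<close>,
      to be summed over the parts, and \<open>1 / w J\<close> in the linear term costs a factor of
      at most 32.\<close>
    have part: "(\<Sum>l\<in>\<L>. (real (card (l \<inter> J)))\<^sup>2) / w J
        \<le> (31 / 32) ^ j * n\<^sup>2 * w J + 32 * K * (\<Sum>l\<in>\<L>. real (card (l \<inter> J)))" if J: "J \<in> \<P>" for J
    proof -
      have "\<eta>' * n \<le> \<eta> / 32 * n"
        using n by (intro mult_right_mono) (auto simp: \<eta>'_def)
      also have "\<dots> = \<eta> * (n / 32)" by simp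
      also have "\<dots> \<le> \<eta> * card J"
        using \<eta> large[OF J] by (intro mult_left_mono) auto
      finally have "few_on_lines \<eta> J X Y"
        using few_on_lines_mono[OF few I sub(1)[OF J]] by (simp add: n_def)
      moreover have "line_family J X Y \<L>"
        using line_family_mono[OF \<L> I sub(1)[OF J]] by simp
      ultimately have "(\<Sum>l\<in>\<L>. (real (card (l \<inter> J)))\<^sup>2)
          \<le> (31 / 32) ^ j * (real (card J))\<^sup>2 + K * (\<Sum>l\<in>\<L>. real (card (l \<inter> J)))"
        using IH sub(2)[OF J] by blast
      then have "(\<Sum>l\<in>\<L>. (real (card (l \<inter> J)))\<^sup>2) / w J
          \<le> ((31 / 32) ^ j * (real (card J))\<^sup>2 + K * (\<Sum>l\<in>\<L>. real (card (l \<inter> J)))) / w J"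
        using w(2)[OF J] by (intro divide_right_mono) auto
      also have "\<dots> = (31 / 32) ^ j * (real (card J))\<^sup>2 / w J + K * (\<Sum>l\<in>\<L>. real (card (l \<inter> J))) * (1 / w J)"
        by (simp add: add_divide_distrib)
      also have "\<dots> \<le> (31 / 32) ^ j * (real (card J))\<^sup>2 / w J + K * (\<Sum>l\<in>\<L>. real (card (l \<inter> J))) * 32"
        using w[OF J] K by (intro add_left_mono mult_left_mono mult_nonneg_nonneg sum_nonneg) (auto simp: field_simps)
      also have "(31 / 32) ^ j * (real (card J))\<^sup>2 / w J = (31 / 32) ^ j * n\<^sup>2 * w J"
        using w(2)[OF J] n by (simp add: w_def power2_eq_square)
      finally show ?thesis by (simp add: mult_ac)
    qed
    have "(\<Sum>l\<in>\<L>. (real (card (l \<inter> I)))\<^sup>2) \<le> (\<Sum>l\<in>\<L>. 31 / 32 * (\<Sum>J\<in>\<P>. (real (card (l \<inter> J)))\<^sup>2 / w J))"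
      using split by (rule sum_mono)
    also have "\<dots> = 31 / 32 * (\<Sum>l\<in>\<L>. \<Sum>J\<in>\<P>. (real (card (l \<inter> J)))\<^sup>2 / w J)"
      by (rule sum_distrib_left[symmetric])
    also have "(\<Sum>l\<in>\<L>. \<Sum>J\<in>\<P>. (real (card (l \<inter> J)))\<^sup>2 / w J) = (\<Sum>J\<in>\<P>. \<Sum>l\<in>\<L>. (real (card (l \<inter> J)))\<^sup>2 / w J)"
      by (rule sum.swap)
    also have "\<dots> = (\<Sum>J\<in>\<P>. (\<Sum>l\<in>\<L>. (real (card (l \<inter> J)))\<^sup>2) / w J)"
      by (simp only: sum_divide_distrib)
    also have "31 / 32 * \<dots> \<le> 31 / 32 * (\<Sum>J\<in>\<P>. (31 / 32) ^ j * n\<^sup>2 * w J + 32 * K * (\<Sum>l\<in>\<L>. real (card (l \<inter> J))))"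
      using part by (intro mult_left_mono sum_mono) auto
    also have "(\<Sum>J\<in>\<P>. (31 / 32) ^ j * n\<^sup>2 * w J + 32 * K * (\<Sum>l\<in>\<L>. real (card (l \<inter> J))))
        = (31 / 32) ^ j * n\<^sup>2 * (\<Sum>J\<in>\<P>. w J) + 32 * K * (\<Sum>J\<in>\<P>. \<Sum>l\<in>\<L>. real (card (l \<inter> J)))"
      by (simp only: sum.distrib sum_distrib_left)
    also have "(\<Sum>J\<in>\<P>. \<Sum>l\<in>\<L>. real (card (l \<inter> J))) = (\<Sum>l\<in>\<L>. \<Sum>J\<in>\<P>. real (card (l \<inter> J)))"
      by (rule sum.swap)
    also have "\<dots> = (\<Sum>l\<in>\<L>. real (card (l \<inter> I)))"
      by (simp add: card_trace)
    also have "31 / 32 * ((31 / 32) ^ j * n\<^sup>2 * (\<Sum>J\<in>\<P>. w J) + 32 * K * \<dots>) \<le> (31 / 32) ^ Suc j * n\<^sup>2 + 32 * K * (\<Sum>l\<in>\<L>. real (card (l \<inter> I)))"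
      using K by (simp add: wsum algebra_simps sum_nonneg)
    finally show ?thesis
      by (simp add: n_def)
  qed simp
  show ?case
    using K \<open>\<eta>' > 0\<close>
    by (intro exI[of _ \<eta>'] conjI exI[of _ "32 * K"] allI impI main) simp_all
qed

text \<open>A weak form of Beck's theorem.\<close>
lemma many_points_on_many_lines:
  "\<exists>\<eta>>0. \<exists>\<delta>::real. \<delta> > 0 \<and> (\<forall>(I :: 'i set) X Y \<L>. finite I \<longrightarrow> few_on_lines \<eta> I X Y \<longrightarrow> line_family I X Y \<L> \<longrightarrow>
    (\<forall>i\<in>I. \<forall>k\<in>I. i \<noteq> k \<longrightarrow> (\<exists>l\<in>\<L>. i \<in> l \<and> k \<in> l)) \<longrightarrow>
    real (card I) / 4 \<le> card {i\<in>I. \<delta> * real (card I) \<le> real (card {l\<in>\<L>. i \<in> l})})"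
proof -
  \<comment> \<open>Enough levels to bring the quadratic term for the rich lines down to
    n^2/16.\<close>
  obtain j where j: "(31 / 32 :: real) ^ j < 1 / 16"
    using real_arch_pow_inv[of "1/16" "31/32"] by auto
  obtain \<eta> K :: real where \<eta>: "\<eta> > 0" and K: "K \<ge> 0"
    and decay: "\<And>(I :: 'i set) X Y \<L>. finite I \<Longrightarrow> few_on_lines \<eta> I X Y \<Longrightarrow> line_family I X Y \<L> \<Longrightarrow>
      (\<Sum>l\<in>\<L>. (real (card (l \<inter> I)))\<^sup>2)
        \<le> (31 / 32) ^ j * (real (card I))\<^sup>2 + K * (\<Sum>l\<in>\<L>. real (card (l \<inter> I)))"
    using line_square_sum_decay[of j] by blast
  \<comment> \<open>A line through one point already contains a point, so the bound 1/8 forces n to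
    be at least 8.\<close>
  define \<eta>' where "\<eta>' = min \<eta> (1 / 8)"
  \<comment> \<open>An upper bound for the size of a poor line that stays positive for
    \<open>K = 0\<close>.\<close>
  define C where "C = 2 * K + 1"
  have C: "C > 0" using K by (simp add: C_def)
  have main: "card I / 4 \<le> card {i\<in>I. 1 / (4 * C) * card I \<le> card {l\<in>\<L>. i \<in> l}}"
    if I: "finite I" and few: "few_on_lines \<eta>' I X Y" and \<L>: "line_family I X Y \<L>"
      and cover: "\<And>i k. i \<in> I \<Longrightarrow> k \<in> I \<Longrightarrow> i \<noteq> k \<Longrightarrow> \<exists>l\<in>\<L>. i \<in> l \<and> k \<in> l"
    for I :: "'i set" and X Y \<L>
  proof (cases "I = {}")
    case False
    define n where "n = real (card I)"
    have n: "n > 0"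
      using I False by (simp add: n_def card_gt_0_iff)
    have fin\<L>: "finite \<L>"
      using \<L> by (simp add: line_family_def)
    have n8: "n \<ge> 8"
    proof -
      obtain i where i: "i \<in> I" using False by blast
      have "0 < card {k\<in>I. 1 * X k + 0 * Y k = X i}"
        using i I by (subst card_gt_0_iff) auto
      then have "1 \<le> real (card {k\<in>I. 1 * X k + 0 * Y k = X i})"
        by linarith
      also have "\<dots> \<le> \<eta>' * n"
        unfolding n_def by (rule few_on_linesD[OF few]) simp
      also have "\<dots> \<le> 1 / 8 * n"
        using n by (intro mult_right_mono) (auto simp: \<eta>'_def)
      finally show ?thesis by simp
    qed
    \<comment> \<open>At this threshold \<open>K * m \<le> m^2 / 2\<close> for a line with
      \<open>m\<close> points, so half of the sum of squares absorbs the linear term of the decay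
      estimate.\<close>
    define rich where "rich = {l\<in>\<L>. 2 * K \<le> real (card (l \<inter> I))}"
    define poor where "poor = {l\<in>\<L>. real (card (l \<inter> I)) < 2 * K}"
    have rich: "line_family I X Y rich"
      using line_family_mono[OF \<L> I] by (auto simp: rich_def)
    have "\<eta>' * n \<le> \<eta> * n"
      using n by (intro mult_right_mono) (auto simp: \<eta>'_def)
    then have "few_on_lines \<eta> I X Y"
      using few_on_lines_mono[OF few I] by (simp add: n_def)
    then have "(\<Sum>l\<in>rich. (real (card (l \<inter> I)))\<^sup>2)
        \<le> (31 / 32) ^ j * n\<^sup>2 + K * (\<Sum>l\<in>rich. real (card (l \<inter> I)))"
      using decay[OF I _ rich] by (simp add: n_def)
    moreover have "K * (\<Sum>l\<in>rich. real (card (l \<inter> I))) \<le> (\<Sum>l\<in>rich. (real (card (l \<inter> I)))\<^sup>2) / 2"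
      unfolding sum_distrib_left sum_divide_distrib
    proof (rule sum_mono)
      fix l assume "l \<in> rich"
      then have "2 * K * card (l \<inter> I) \<le> card (l \<inter> I) * real (card (l \<inter> I))"
        by (intro mult_right_mono) (auto simp: rich_def)
      then show "K * card (l \<inter> I) \<le> (real (card (l \<inter> I)))\<^sup>2 / 2"
        by (simp add: power2_eq_square)
    qed
    moreover have "(31 / 32) ^ j * n\<^sup>2 \<le> 1 / 16 * n\<^sup>2"
      using j by (intro mult_right_mono) auto
    ultimately have rich_sum: "(\<Sum>l\<in>rich. (real (card (l \<inter> I)))\<^sup>2) \<le> n\<^sup>2 / 8"
      by linarith
    define R where "R = (\<Union>l\<in>rich. (l \<inter> I) \<times> (l \<inter> I) - Id)"
    have "real (card R) = (\<Sum>l\<in>rich. real (card ((l \<inter> I) \<times> (l \<inter> I) - Id)))"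
      using sum_card_offdiag[OF I rich] by (simp add: R_def flip: of_nat_sum)
    also have "\<dots> \<le> (\<Sum>l\<in>rich. (real (card (l \<inter> I)))\<^sup>2)"
      using I by (intro sum_mono) (simp add: card_offdiag)
    finally have R: "real (card R) \<le> n\<^sup>2 / 8"
      using rich_sum by linarith
    define N where "N i = {k\<in>I - {i}. \<exists>l\<in>poor. i \<in> l \<and> k \<in> l}" for i
    have finN: "finite (N i)" for i
      using I by (simp add: N_def)
    have "I \<times> I - Id \<subseteq> R \<union> Sigma I N"
    proof (intro subrelI, rule ccontr)
      fix i k assume ik: "(i, k) \<in> I \<times> I - Id" "(i, k) \<notin> R \<union> Sigma I N"
      then obtain l where l: "l \<in> \<L>" "i \<in> l" "k \<in> l"
        using cover by blast
      with ik have "l \<in> rich"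
        by (auto simp: N_def rich_def poor_def)
      with ik l show False
        by (auto simp: R_def)
    qed
    then have "card (I \<times> I - Id) \<le> card (R \<union> Sigma I N)"
      using I finN fin\<L> by (intro card_mono) (auto simp: R_def rich_def)
    also have "\<dots> \<le> card R + card (Sigma I N)"
      by (rule card_Un_le)
    also have "card (Sigma I N) = (\<Sum>i\<in>I. card (N i))"
      using I finN by (simp add: card_SigmaI)
    finally have "n\<^sup>2 - n \<le> card R + (\<Sum>i\<in>I. real (card (N i)))"
      using card_offdiag[OF I] by (simp add: n_def flip: of_nat_sum)
    moreover have "8 * n \<le> n\<^sup>2"
      using n8 by (simp add: power2_eq_square)
    \<comment> \<open>The diagonal and the pairs on rich lines account for at most n^2/8
      each.\<close>
    ultimately have many: "n\<^sup>2 / 2 \<le> (\<Sum>i\<in>I. real (card (N i)))"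
      using R n by linarith
    \<comment> \<open>Averaging: points outside \<open>G\<close> contribute at most n/4 each and
      those in \<open>G\<close> at most n, so \<open>G\<close> has at least n/4 members.\<close>
    define G where "G = {i\<in>I. n / 4 \<le> card (N i)}"
    have "(\<Sum>i\<in>I. real (card (N i))) \<le> (\<Sum>i\<in>I. (if i \<in> G then n else 0) + n / 4)"
    proof (rule sum_mono)
      fix i assume "i \<in> I"
      have "card (N i) \<le> card I"
        using I by (intro card_mono) (auto simp: N_def)
      then show "real (card (N i)) \<le> (if i \<in> G then n else 0) + n / 4"
        using \<open>i \<in> I\<close> n by (auto simp: G_def n_def)
    qed
    also have "\<dots> = card G * n + n * n / 4"
      using I by (simp add: sum.distrib n_def G_def flip: sum.inter_filter)
    finally have "n * n / 4 \<le> card G * n"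
      using many by (simp add: power2_eq_square)
    then have G: "n / 4 \<le> card G"
      using n by simp
    \<comment> \<open>Poor lines have at most \<open>C\<close> points, so many of them through
      \<open>i\<close> are needed to cover \<open>N i\<close>.\<close>
    have "1 / (4 * C) * n \<le> card {l\<in>\<L>. i \<in> l}" if "i \<in> G" for i
    proof -
      have "N i \<subseteq> (\<Union>l\<in>{l\<in>poor. i \<in> l}. l \<inter> I)"
        by (auto simp: N_def)
      then have "card (N i) \<le> card (\<Union>l\<in>{l\<in>poor. i \<in> l}. l \<inter> I)"
        using I fin\<L> by (intro card_mono) (auto simp: poor_def)
      also have "\<dots> \<le> (\<Sum>l\<in>{l\<in>poor. i \<in> l}. card (l \<inter> I))"
        using fin\<L> by (intro card_UN_le) (simp add: poor_def)
      finally have "real (card (N i)) \<le> (\<Sum>l\<in>{l\<in>poor. i \<in> l}. real (card (l \<inter> I)))"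
        by (simp flip: of_nat_sum)
      also have "\<dots> \<le> (\<Sum>l\<in>{l\<in>poor. i \<in> l}. C)"
        by (intro sum_mono) (auto simp: poor_def C_def)
      also have "\<dots> = C * card {l\<in>poor. i \<in> l}" by simp
      also have "\<dots> \<le> C * card {l\<in>\<L>. i \<in> l}"
        using fin\<L> C by (intro mult_left_mono of_nat_mono card_mono) (auto simp: poor_def)
      finally have "n / 4 \<le> C * card {l\<in>\<L>. i \<in> l}"
        using that by (auto simp: G_def)
      then show ?thesis
        using C by (simp add: field_simps)
    qed
    then have "G \<subseteq> {i\<in>I. 1 / (4 * C) * n \<le> card {l\<in>\<L>. i \<in> l}}"
      by (auto simp: G_def)
    then have "card G \<le> card {i\<in>I. 1 / (4 * C) * n \<le> card {l\<in>\<L>. i \<in> l}}"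
      using I by (intro card_mono) auto
    then show ?thesis
      using G by (simp add: n_def)
  qed simp
  have pos: "\<eta>' > 0" "1 / (4 * C) > 0"
    using \<eta> C by (auto simp: \<eta>'_def)
  show ?thesis
  proof (rule exI[of _ \<eta>'], rule conjI[OF pos(1)], rule exI[of _ "1 / (4 * C)"],
      rule conjI[OF pos(2)], intro allI impI)
    fix I :: "'i set" and X Y \<L>
    assume "finite I" "few_on_lines \<eta>' I X Y" "line_family I X Y \<L>"
      and "\<forall>i\<in>I. \<forall>k\<in>I. i \<noteq> k \<longrightarrow> (\<exists>l\<in>\<L>. i \<in> l \<and> k \<in> l)"
    then show "real (card I) / 4 \<le> real (card {i\<in>I. 1 / (4 * C) * real (card I) \<le> real (card {l\<in>\<L>. i \<in> l})})"
      by (intro main) simp_all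
  qed
qed

subsection \<open>Flats with few parallel pairs\<close>

text \<open>The pairs are ordered and, for a subspace \<open>U\<close>, include the diagonal: their
  number is the sum of the squares of the numbers of points in the cosets of
  \<open>U\<close>.\<close>

definition parallel_pairs :: "'a::euclidean_space set \<Rightarrow> 'a set \<Rightarrow> ('a \<times> 'a) set" where
  "parallel_pairs T U = {(x, y)\<in>T \<times> T. x - y \<in> U}"

text \<open>These spans correspond to the points of the central projection of \<open>T\<close> from
  \<open>span P\<close>.\<close>

definition extensions :: "'a::euclidean_space set \<Rightarrow> 'a set \<Rightarrow> 'a set set" where
  "extensions P T = (\<lambda>x. span (insert x P)) ` (T - span P)"

text \<open>The comparison is with \<open>dim T\<close>, not with the ambient dimension, because the
  recursion passes to subsets of smaller span.\<close>

definition few_on_subspaces :: "real \<Rightarrow> 'a::euclidean_space set \<Rightarrow> bool" where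
  "few_on_subspaces \<eta> T \<longleftrightarrow>
    (\<forall>U. subspace U \<longrightarrow> dim U < dim T \<longrightarrow> real (card (T \<inter> U)) \<le> \<eta> * real (card T))"

lemma finite_parallel_pairs: "finite T \<Longrightarrow> finite (parallel_pairs T U)"
  by (rule finite_subset[of _ "T \<times> T"]) (auto simp: parallel_pairs_def)

text \<open>Steinitz exchange; it makes different one-step extensions of \<open>span P\<close> meet
  only in \<open>span P\<close>.\<close>

lemma span_insert_exchange:
  fixes d :: "'a::euclidean_space"
  assumes "d \<in> span (insert x P)" "d \<notin> span P"
  shows "span (insert x P) = span (insert d P)"
proof (rule span_eq[THEN iffD2], intro conjI subsetI)
  fix z assume "z \<in> insert x P"
  then show "z \<in> span (insert d P)"
    using in_span_insert[OF assms] by (auto intro: span_base)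
next
  fix z assume "z \<in> insert d P"
  then show "z \<in> span (insert x P)"
    using assms(1) by (auto intro: span_base)
qed

text \<open>Distinct extensions of \<open>span P\<close> contribute disjoint sets of new parallel pairs.\<close>
lemma card_popular_extensions:
  fixes T :: "'a::euclidean_space set" and K :: real
  assumes T: "finite T" and R: "finite R" "inj_on (\<lambda>x. span (insert x P)) R"
  defines "Bad \<equiv> {x\<in>R. card (parallel_pairs T (span P)) + K * card T < card (parallel_pairs T (span (insert x P)))}"
  shows "real (card Bad) * (K * card T) \<le> (real (card T))\<^sup>2"
proof -
  define E where "E x = parallel_pairs T (span (insert x P)) - parallel_pairs T (span P)" for x
  have finE: "finite (E x)" for x
    using finite_parallel_pairs[OF T] by (simp add: E_def)
  have "real (card Bad) * (K * card T) = (\<Sum>x\<in>Bad. K * card T)"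
    by simp
  also have "\<dots> \<le> (\<Sum>x\<in>Bad. real (card (E x)))"
  proof (rule sum_mono)
    fix x assume "x \<in> Bad"
    moreover have "parallel_pairs T (span P) \<subseteq> parallel_pairs T (span (insert x P))"
      using span_mono[of P "insert x P"] by (auto simp: parallel_pairs_def)
    then have "card (parallel_pairs T (span (insert x P))) = card (E x) + card (parallel_pairs T (span P))"
      unfolding E_def using finite_parallel_pairs[OF T]
      by (metis card_mono card_Diff_subset le_add_diff_inverse2)
    ultimately show "K * card T \<le> real (card (E x))"
      by (simp add: Bad_def)
  qed
  also have "\<dots> = real (card (\<Union>x\<in>Bad. E x))"
  proof -
    have "card (\<Union>x\<in>Bad. E x) = (\<Sum>x\<in>Bad. card (E x))"
    proof (rule card_UN_disjoint)
      show "\<forall>x\<in>Bad. \<forall>y\<in>Bad. x \<noteq> y \<longrightarrow> E x \<inter> E y = {}"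
      proof (intro ballI impI, rule ccontr)
        fix x y assume xy: "x \<in> Bad" "y \<in> Bad" "x \<noteq> y" "E x \<inter> E y \<noteq> {}"
        then obtain d where "d \<in> span (insert x P)" "d \<in> span (insert y P)" "d \<notin> span P"
          by (auto simp: E_def parallel_pairs_def)
        then have "span (insert x P) = span (insert y P)"
          using span_insert_exchange by metis
        then show False
          using xy R(2) by (auto simp: Bad_def dest: inj_onD)
      qed
    qed (use R finE in \<open>auto simp: Bad_def\<close>)
    then show ?thesis by simp
  qed
  also have "\<dots> \<le> real (card (T \<times> T))"
    using T by (intro of_nat_mono card_mono) (auto simp: E_def parallel_pairs_def)
  finally show ?thesis
    by (simp add: card_cartesian_product power2_eq_square)
qed

text \<open>After projection from \<open>span P\<close>, two distinct points determine a line. The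
  reason is dimension: \<open>P\<close> with \<open>u\<close> and \<open>v\<close> is an independent
  set of size \<open>card P + 2\<close> in a space of at most that dimension.\<close>

lemma span_insert_insert_unique:
  fixes P :: "'a::euclidean_space set"
  assumes P: "independent P" and uv: "u \<notin> span P" "v \<notin> span P" "span (insert u P) \<noteq> span (insert v P)"
    and mem: "u \<in> span (insert x (insert y P))" "v \<in> span (insert x (insert y P))"
  shows "v \<notin> span (insert u P)" "span (insert x (insert y P)) = span (insert v (insert u P))"
proof -
  show v: "v \<notin> span (insert u P)"
    using span_insert_exchange[of v u P] uv by auto
  have indep: "independent (insert v (insert u P))"
    using P uv v by (auto simp: independent_insert span_base)
  have "card (insert v (insert u P)) = card P + 2"
    using v uv independent_imp_finite[OF P] by (auto simp: card_insert_if span_base)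
  moreover have "dim (span (insert x (insert y P))) \<le> card P + 2"
    using dim_le_card'[of "insert x (insert y P)"] independent_imp_finite[OF P]
    by (auto simp: card_insert_if split: if_splits)
  moreover have sub: "insert v (insert u P) \<subseteq> span (insert x (insert y P))"
    using mem by (auto intro: span_base)
  ultimately have "dim (span (insert x (insert y P))) \<le> card (insert v (insert u P))"
    by simp
  then have "span (insert x (insert y P)) \<subseteq> span (insert v (insert u P))"
    by (rule card_ge_dim_independent[OF sub indep])
  moreover have "span (insert v (insert u P)) \<subseteq> span (insert x (insert y P))"
    using sub by (rule span_minimal) (rule subspace_span)
  ultimately show "span (insert x (insert y P)) = span (insert v (insert u P))"
    by blast
qed

section \<open>Central projection from a flat to a plane\<close>

lemma independent_triple:
  fixes a b c :: "'a::euclidean_space"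
  assumes "independent {a, b, c}" "a \<noteq> b" "a \<noteq> c" "b \<noteq> c" "p *\<^sub>R a + q *\<^sub>R b + r *\<^sub>R c = 0"
  shows "p = 0 \<and> q = 0 \<and> r = 0"
proof -
  define u where "u v = (if v = a then p else if v = b then q else r)" for v
  have "(\<Sum>v\<in>{a, b, c}. u v *\<^sub>R v) = 0"
    using assms by (simp add: u_def add.assoc)
  then have "u a = 0" "u b = 0" "u c = 0"
    using assms(1) by (auto dest: independentD[of "{a, b, c}" "{a, b, c}" u])
  then show ?thesis
    using assms by (auto simp: u_def)
qed

text \<open>The orthogonal hyperplane of \<open>h\<close> cuts \<open>span T\<close> in a proper
  subspace, as it omits \<open>h\<close> itself.\<close>

lemma few_on_subspaces_hyperplane:
  fixes \<eta> :: real
  assumes few: "few_on_subspaces \<eta> T" and h: "h \<in> span T" "h \<noteq> 0"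
  shows "card {z\<in>T. h \<bullet> z = 0} \<le> \<eta> * card T"
proof -
  define U where "U = {z\<in>span T. h \<bullet> z = 0}"
  have sub: "subspace U"
    unfolding U_def by (auto simp: subspace_def span_add span_scale span_zero inner_add_right)
  have "h \<notin> U"
    using h by (simp add: U_def)
  moreover have "span U = U"
    using sub by (simp add: span_eq_iff)
  moreover have "U \<subseteq> span T"
    by (auto simp: U_def)
  ultimately have "span U \<subset> span T"
    using h by blast
  then have "dim U < dim T"
    by (rule dim_psubset)
  then have "card (T \<inter> U) \<le> \<eta> * card T"
    using few sub by (auto simp: few_on_subspaces_def)
  moreover have "T \<inter> U = {z\<in>T. h \<bullet> z = 0}"
    by (auto simp: U_def span_base)
  ultimately show ?thesis by simp
qed

text \<open>The orthogonal complement of \<open>span P\<close> in \<open>span T\<close> has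
  dimension at least 3. Inner products with \<open>a\<close>, \<open>b\<close>, \<open>c\<close>
  will serve as homogeneous coordinates of the projection.\<close>

lemma three_orthogonal_vectors:
  fixes T :: "'a::euclidean_space set"
  assumes "independent P" "P \<subseteq> T" "card P + 3 \<le> dim T"
  shows "\<exists>a b c. {a, b, c} \<subseteq> span T \<and> independent {a, b, c} \<and> a \<noteq> b \<and> a \<noteq> c \<and> b \<noteq> c \<and>
    (\<forall>v\<in>span P. a \<bullet> v = 0 \<and> b \<bullet> v = 0 \<and> c \<bullet> v = 0)"
proof -
  define D where "D = {y\<in>span T. \<forall>v\<in>span P. orthogonal v y}"
  have "dim D + dim (span P) = dim (span T)"
    unfolding D_def by (intro dim_subspace_orthogonal_to_vectors subspace_span span_mono assms)
  then have "3 \<le> dim D"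
    using assms by (simp add: dim_eq_card_independent)
  moreover obtain B where B: "B \<subseteq> D" "independent B" "card B = dim D"
    using basis_exists[of D] by metis
  ultimately obtain S where S: "S \<subseteq> B" "card S = 3"
    by (metis obtain_subset_with_card_n)
  then obtain a b c where abc: "S = {a, b, c}" "a \<noteq> b" "a \<noteq> c" "b \<noteq> c"
    by (auto simp: card_3_iff)
  have "independent S"
    using B(2) S(1) independent_mono by blast
  moreover have "S \<subseteq> D"
    using B S by blast
  then have "S \<subseteq> span T" "\<And>w v. w \<in> S \<Longrightarrow> v \<in> span P \<Longrightarrow> w \<bullet> v = 0"
    by (auto simp: D_def orthogonal_def inner_commute)
  ultimately show ?thesis
    using abc(2-) unfolding abc(1) by blast
qed

text \<open>Modulo \<open>span P\<close>, every vector of the flat is a combination of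
  \<open>x\<close> and \<open>y\<close>. A homogeneous linear relation between the three coordinates
  that holds at \<open>x\<close> and \<open>y\<close> therefore holds on the whole flat.\<close>

lemma on_line_trace:
  fixes a b c :: "'a::euclidean_space"
  assumes orth: "\<And>v. v \<in> span P \<Longrightarrow> a \<bullet> v = 0 \<and> b \<bullet> v = 0 \<and> c \<bullet> v = 0"
    and J: "J \<subseteq> span (insert x (insert y P))" "\<And>z. z \<in> J \<Longrightarrow> c \<bullet> z \<noteq> 0"
    and xy: "c \<bullet> x \<noteq> 0" "c \<bullet> y \<noteq> 0"
  shows "on_line J (\<lambda>z. (a \<bullet> z) / (c \<bullet> z)) (\<lambda>z. (b \<bullet> z) / (c \<bullet> z))"
proof -
  define X where "X z = (a \<bullet> z) / (c \<bullet> z)" for z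
  define Y where "Y z = (b \<bullet> z) / (c \<bullet> z)" for z
  obtain p q r where pq: "p \<noteq> 0 \<or> q \<noteq> 0" and on: "p * X x + q * Y x = r" "p * X y + q * Y y = r"
  proof (cases "X x = X y \<and> Y x = Y y")
    \<comment> \<open>If \<open>x\<close> and \<open>y\<close> have the same projection, a vertical
      line through it will do.\<close>
    case True
    then show ?thesis using that[of 1 0 "X x"] by simp
  next
    case False
    then show ?thesis
      using that[of "Y y - Y x" "X x - X y" "(Y y - Y x) * X x + (X x - X y) * Y x"]
      by (auto simp: algebra_simps)
  qed
  have hx: "p * (a \<bullet> x) + q * (b \<bullet> x) = r * (c \<bullet> x)" and hy: "p * (a \<bullet> y) + q * (b \<bullet> y) = r * (c \<bullet> y)"
    using on xy by (auto simp: X_def Y_def field_simps)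
  have "p * X z + q * Y z = r" if "z \<in> J" for z
  proof -
    have "z \<in> span (insert x (insert y P))"
      using J(1) that by auto
    then obtain s t where "z - s *\<^sub>R x - t *\<^sub>R y \<in> span P"
      by (auto simp: span_breakdown_eq)
    from orth[OF this] have az: "a \<bullet> z = s * (a \<bullet> x) + t * (a \<bullet> y)"
      and bz: "b \<bullet> z = s * (b \<bullet> x) + t * (b \<bullet> y)"
      and cz: "c \<bullet> z = s * (c \<bullet> x) + t * (c \<bullet> y)"
      by (simp_all add: inner_diff_right)
    have "p * (a \<bullet> z) + q * (b \<bullet> z)
        = s * (p * (a \<bullet> x) + q * (b \<bullet> x)) + t * (p * (a \<bullet> y) + q * (b \<bullet> y))"
      unfolding az bz by (simp add: algebra_simps)
    also have "\<dots> = r * (c \<bullet> z)"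
      unfolding cz hx hy by (simp add: algebra_simps)
    finally show ?thesis
      using J(2)[OF that] by (simp add: X_def Y_def field_simps)
  qed
  then show ?thesis
    using pq unfolding on_line_def
    by (intro exI[of _ p] exI[of _ q] exI[of _ r]) (simp add: X_def Y_def)
qed

text \<open>Central projection from \<open>span P\<close> to a plane turns extensions of \<open>span P\<close> into points, to which
  the planar result applies.\<close>
lemma many_extensions_step:
  "\<exists>\<epsilon>::real. \<epsilon> > 0 \<and> (\<exists>\<delta>::real. \<delta> > 0 \<and> (\<forall>(\<eta> :: real) (T :: 'a::euclidean_space set) P R.
    finite T \<longrightarrow> P \<subseteq> T \<longrightarrow> independent P \<longrightarrow> card P + 3 \<le> dim T \<longrightarrow> few_on_subspaces \<eta> T \<longrightarrow>
    R \<subseteq> T - span P \<longrightarrow> inj_on (\<lambda>x. span (insert x P)) R \<longrightarrow> \<eta> * real (card T) \<le> \<epsilon> * real (card R) \<longrightarrow>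
    real (card R) / 8 \<le> card {x\<in>R. \<delta> * real (card R) \<le> real (card (extensions (insert x P) T))}))"
proof -
  obtain \<eta>0 \<delta>0 :: real where pos: "\<eta>0 > 0" "\<delta>0 > 0"
    and beck: "\<And>(I :: 'a set) X Y \<L>. finite I \<Longrightarrow> few_on_lines \<eta>0 I X Y \<Longrightarrow> line_family I X Y \<L> \<Longrightarrow>
      \<forall>i\<in>I. \<forall>k\<in>I. i \<noteq> k \<longrightarrow> (\<exists>l\<in>\<L>. i \<in> l \<and> k \<in> l) \<Longrightarrow>
      real (card I) / 4 \<le> card {i\<in>I. \<delta>0 * real (card I) \<le> real (card {l\<in>\<L>. i \<in> l})}"
    using many_points_on_many_lines by (elim exE conjE) blast
  \<comment> \<open>The bound 1/2 leaves at least half of \<open>R\<close> off the hyperplane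
    orthogonal to \<open>c\<close>; \<open>\<eta>0 / 2\<close> compensates for passing from
    \<open>R\<close> to that half.\<close>
  define \<epsilon> where "\<epsilon> = min (1 / 2) (\<eta>0 / 2)"
  have main: "real (card R) / 8 \<le> card {x\<in>R. \<delta>0 / 2 * real (card R) \<le> real (card (extensions (insert x P) T))}"
    if T: "finite T" and P: "P \<subseteq> T" "independent P" and dim: "card P + 3 \<le> dim T"
      and few: "few_on_subspaces \<eta> T" and R: "R \<subseteq> T - span P" "inj_on (\<lambda>x. span (insert x P)) R"
      and large: "\<eta> * real (card T) \<le> \<epsilon> * real (card R)"
    for \<eta> :: real and T P R :: "'a set"
  proof -
    have finR: "finite R"
      using R T finite_subset by blast
    obtain a b c where abc: "{a, b, c} \<subseteq> span T" "independent {a, b, c}" "a \<noteq> b" "a \<noteq> c" "b \<noteq> c"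
      and orth: "\<And>v. v \<in> span P \<Longrightarrow> a \<bullet> v = 0 \<and> b \<bullet> v = 0 \<and> c \<bullet> v = 0"
      using three_orthogonal_vectors[OF P(2,1) dim] by metis
    \<comment> \<open>Points projected to infinity are dropped.\<close>
    define R' where "R' = {z\<in>R. c \<bullet> z \<noteq> 0}"
    define X where "X = (\<lambda>z. (a \<bullet> z) / (c \<bullet> z))"
    define Y where "Y = (\<lambda>z. (b \<bullet> z) / (c \<bullet> z))"
    have finR': "finite R'" and R': "R' \<subseteq> R"
      using finR by (auto simp: R'_def)
    have le_half: "\<epsilon> * card R \<le> 1 / 2 * real (card R)"
      by (intro mult_right_mono) (auto simp: \<epsilon>_def)
    have half: "real (card R) / 2 \<le> card R'"
    proof -
      have "c \<noteq> 0"
        using abc(2) dependent_zero[of "{a, b, c}"] by auto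
      then have "card {z\<in>T. c \<bullet> z = 0} \<le> \<eta> * card T"
        using abc(1) by (intro few_on_subspaces_hyperplane[OF few]) auto
      moreover have "card (R - R') \<le> card {z\<in>T. c \<bullet> z = 0}"
        using T R by (intro card_mono) (auto simp: R'_def)
      moreover have "card R = card (R - R') + card R'"
        using card_Diff_subset[OF finR' R'] card_mono[OF finR R'] by simp
      ultimately show ?thesis
        using large le_half by linarith
    qed
    have "few_on_lines \<eta>0 R' X Y"
      unfolding few_on_lines_def
    proof (intro allI impI)
      fix p q r :: real assume pq: "(p, q) \<noteq> (0, 0)"
      \<comment> \<open>For points with \<open>c \<bullet> z \<noteq> 0\<close>, the projected line
        \<open>p * X z + q * Y z = r\<close> is the condition
        \<open>h \<bullet> z = 0\<close>.\<close>
      define h where "h = p *\<^sub>R a + q *\<^sub>R b - r *\<^sub>R c"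
      have "h \<noteq> 0"
        using independent_triple[OF abc(2-5), of p q "-r"] pq by (auto simp: h_def)
      moreover have "h \<in> span T"
        using abc(1) by (auto simp: h_def intro!: span_add span_diff span_scale)
      ultimately have "card {z\<in>T. h \<bullet> z = 0} \<le> \<eta> * card T"
        by (intro few_on_subspaces_hyperplane[OF few])
      also have "\<dots> \<le> \<eta>0 / 2 * card R"
        using large by (rule order_trans) (intro mult_right_mono, auto simp: \<epsilon>_def)
      also have "\<dots> \<le> \<eta>0 * card R'"
        using half pos by simp
      finally have "card {z\<in>T. h \<bullet> z = 0} \<le> \<eta>0 * card R'" .
      moreover have "card {i\<in>R'. p * X i + q * Y i = r} \<le> card {z\<in>T. h \<bullet> z = 0}"
      proof (rule card_mono)
        show "{i\<in>R'. p * X i + q * Y i = r} \<subseteq> {z\<in>T. h \<bullet> z = 0}"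
        proof safe
          fix z assume "z \<in> R'" and eq: "r = p * X z + q * Y z"
          then show "z \<in> T"
            using R' R by blast
          have "c \<bullet> z \<noteq> 0"
            using \<open>z \<in> R'\<close> by (simp add: R'_def)
          then show "h \<bullet> z = 0"
            unfolding h_def eq by (simp add: X_def Y_def inner_add_left inner_diff_left field_simps)
        qed
      qed (use T in simp)
      ultimately show "real (card {i\<in>R'. p * X i + q * Y i = r}) \<le> \<eta>0 * real (card R')"
        by linarith
    qed
    define flat where "flat = (\<lambda>(x, y). span (insert x (insert y P)))"
    define \<L> where "\<L> = flat ` (R' \<times> R' - Id)"
    have outside: "u \<notin> span P" if "u \<in> R'" for u
      using that R' R by blast
    have distinct: "span (insert u P) \<noteq> span (insert v P)" if "u \<in> R'" "v \<in> R'" "u \<noteq> v" for u v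
      using that R' R(2) by (auto dest: inj_onD)
    have unique: "v \<notin> span (insert u P)" "l = span (insert v (insert u P))"
      if l: "l \<in> \<L>" and uv: "u \<in> l" "v \<in> l" "u \<in> R'" "v \<in> R'" "u \<noteq> v" for l u v
    proof -
      obtain x y where xy: "l = span (insert x (insert y P))"
        using l by (auto simp: \<L>_def flat_def)
      show "v \<notin> span (insert u P)" "l = span (insert v (insert u P))"
        using span_insert_insert_unique[OF P(2) outside outside distinct, of u v x y] uv
        unfolding xy by simp_all
    qed
    have "line_family R' X Y \<L>"
      unfolding line_family_def
    proof (intro conjI ballI impI)
      show "finite \<L>"
        using finR' by (simp add: \<L>_def)
    next
      fix l assume "l \<in> \<L>"
      then obtain x y where xy: "x \<in> R'" "y \<in> R'" "l = span (insert x (insert y P))"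
        by (auto simp: \<L>_def flat_def)
      show "on_line (l \<inter> R') X Y"
        unfolding X_def Y_def
        by (rule on_line_trace[where P = P and x = x and y = y]) (use xy orth in \<open>auto simp: R'_def\<close>)
    next
      fix l l' assume l: "l \<in> \<L>" "l' \<in> \<L>" "l \<noteq> l'"
      have "u = v" if "u \<in> l \<inter> l' \<inter> R'" "v \<in> l \<inter> l' \<inter> R'" for u v
        using unique(2)[OF l(1), of u v] unique(2)[OF l(2), of u v] that l(3) by blast
      then show "card (l \<inter> l' \<inter> R') \<le> 1"
        using finR' by (simp add: card_le_Suc0_iff_eq)
    qed
    moreover have "\<forall>i\<in>R'. \<forall>k\<in>R'. i \<noteq> k \<longrightarrow> (\<exists>l\<in>\<L>. i \<in> l \<and> k \<in> l)"
    proof (intro ballI impI)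
      fix i k assume "i \<in> R'" "k \<in> R'" "i \<noteq> k"
      then have "flat (i, k) \<in> \<L>"
        by (auto simp: \<L>_def)
      moreover have "i \<in> flat (i, k)" "k \<in> flat (i, k)"
        by (auto simp: flat_def intro: span_base)
      ultimately show "\<exists>l\<in>\<L>. i \<in> l \<and> k \<in> l" by blast
    qed
    ultimately have G: "real (card R') / 4 \<le> card {i\<in>R'. \<delta>0 * real (card R') \<le> real (card {l\<in>\<L>. i \<in> l})}"
      using beck[OF finR' \<open>few_on_lines \<eta>0 R' X Y\<close>] by blast
    \<comment> \<open>Each flat through \<open>i\<close> contains another representative
      \<open>u\<close>, and is thus the extension of \<open>insert i P\<close> by
      \<open>u\<close>.\<close>
    have ext: "card {l\<in>\<L>. i \<in> l} \<le> card (extensions (insert i P) T)" if i: "i \<in> R'" for i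
    proof (rule card_mono)
      show "finite (extensions (insert i P) T)"
        using T by (simp add: extensions_def)
      show "{l\<in>\<L>. i \<in> l} \<subseteq> extensions (insert i P) T"
      proof safe
        fix l assume l: "l \<in> \<L>" "i \<in> l"
        then obtain x y where xy: "x \<in> R'" "y \<in> R'" "x \<noteq> y" "l = span (insert x (insert y P))"
          by (auto simp: \<L>_def flat_def)
        then have "x \<in> l" "y \<in> l"
          by (auto intro: span_base)
        then obtain u where u: "u \<in> R'" "u \<in> l" "u \<noteq> i"
          using xy by metis
        have "u \<in> T - span (insert i P)" "l = span (insert u (insert i P))"
          using unique[OF l(1) l(2) u(2) i u(1)] u R' R by auto
        then show "l \<in> extensions (insert i P) T"
          unfolding extensions_def by blast
      qed
    qed
    have "{i\<in>R'. \<delta>0 * real (card R') \<le> real (card {l\<in>\<L>. i \<in> l})}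
        \<subseteq> {x\<in>R. \<delta>0 / 2 * real (card R) \<le> real (card (extensions (insert x P) T))}"
    proof safe
      fix i assume i: "i \<in> R'" "\<delta>0 * real (card R') \<le> real (card {l\<in>\<L>. i \<in> l})"
      then show "i \<in> R"
        using R' by blast
      have "\<delta>0 / 2 * real (card R) \<le> \<delta>0 * real (card R')"
        using half pos by simp
      also note i(2)
      also have "real (card {l\<in>\<L>. i \<in> l}) \<le> real (card (extensions (insert i P) T))"
        using ext[OF i(1)] by simp
      finally show "\<delta>0 / 2 * real (card R) \<le> real (card (extensions (insert i P) T))" .
    qed
    then have "card {i\<in>R'. \<delta>0 * real (card R') \<le> real (card {l\<in>\<L>. i \<in> l})}
        \<le> card {x\<in>R. \<delta>0 / 2 * real (card R) \<le> real (card (extensions (insert x P) T))}"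
      using finR by (intro card_mono) auto
    then show ?thesis
      using G half by linarith
  qed
  have "\<epsilon> > 0" "\<delta>0 / 2 > 0"
    using pos by (auto simp: \<epsilon>_def)
  then show ?thesis
    by (intro exI[of _ \<epsilon>] exI[of _ "\<delta>0 / 2"] conjI allI impI main)
qed

section \<open>Greedy choice of a flat with few parallel pairs\<close>

lemma few_on_subspaces_mono:
  fixes \<eta> \<eta>' :: real
  assumes "few_on_subspaces \<eta> T" "\<eta> \<le> \<eta>'"
  shows "few_on_subspaces \<eta>' T"
proof -
  have "\<eta> * real (card T) \<le> \<eta>' * real (card T)"
    using assms(2) by (intro mult_right_mono) auto
  then show ?thesis
    using assms(1) unfolding few_on_subspaces_def by (meson order_trans)
qed

lemma extension_representatives:
  "\<exists>R\<subseteq>T - span P. inj_on (\<lambda>x. span (insert x P)) R \<and> card R = card (extensions P T)"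
proof -
  have "extensions P T \<subseteq> (\<lambda>x. span (insert x P)) ` (T - span P)"
    by (simp add: extensions_def)
  then have "\<exists>R. R \<subseteq> T - span P \<and> inj_on (\<lambda>x. span (insert x P)) R \<and>
      extensions P T = (\<lambda>x. span (insert x P)) ` R"
    by (rule subset_image_inj[THEN iffD1])
  then obtain R where "R \<subseteq> T - span P \<and> inj_on (\<lambda>x. span (insert x P)) R \<and>
      extensions P T = (\<lambda>x. span (insert x P)) ` R"
    by (rule exE)
  then show ?thesis
    by (intro exI[of _ R]) (simp add: card_image)
qed

text \<open>If every member of \<open>G\<close> were popular, the disjoint sets of new pairs would
  together exceed all n^2 pairs of \<open>T\<close>.\<close>

lemma few_popular_extensions:
  fixes T :: "'a::euclidean_space set" and K :: real
  assumes T: "finite T" "T \<noteq> {}" and R: "finite R" "inj_on (\<lambda>x. span (insert x P)) R"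
    and G: "G \<subseteq> R" "real (card T) < K * real (card G)" and "K > 0"
  shows "\<exists>x\<in>G. real (card (parallel_pairs T (span (insert x P))))
    \<le> real (card (parallel_pairs T (span P))) + K * real (card T)"
proof (rule ccontr)
  assume neg: "\<not> ?thesis"
  define Bad where "Bad = {x\<in>R. card (parallel_pairs T (span P)) + K * card T < card (parallel_pairs T (span (insert x P)))}"
  have "G \<subseteq> Bad"
    using neg G(1) by (auto simp: Bad_def)
  then have "card G \<le> card Bad"
    using R by (intro card_mono) (auto simp: Bad_def)
  then have "real (card G) * (K * card T) \<le> real (card Bad) * (K * card T)"
    using \<open>K > 0\<close> by (intro mult_right_mono) auto
  also have "\<dots> \<le> (real (card T))\<^sup>2"
    unfolding Bad_def by (rule card_popular_extensions[OF T(1) R])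
  finally have "(K * card G) * card T \<le> real (card T) * card T"
    by (simp add: power2_eq_square mult_ac)
  moreover have "0 < real (card T)"
    using T by (simp add: card_gt_0_iff)
  ultimately have "K * card G \<le> card T"
    by simp
  then show False
    using G(2) by simp
qed

text \<open>Two proportional vectors on the affine hyperplane \<open>w \<bullet> x = 1\<close> are
  equal.\<close>

lemma span_singletons_inj:
  fixes T :: "'a::euclidean_space set"
  assumes "\<And>x. x \<in> T \<Longrightarrow> w \<bullet> x = 1"
  shows "inj_on (\<lambda>x. span {x}) T"
proof (rule inj_onI)
  fix x y assume xy: "x \<in> T" "y \<in> T" "span {x} = span {y}"
  then have "x \<in> span {y}"
    using span_base[of x "{x}"] by simp
  then obtain s where "x = s *\<^sub>R y"
    by (auto simp: span_singleton)
  then show "x = y"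
    using assms[OF xy(1)] assms[OF xy(2)] by simp
qed

text \<open>The invariant of the greedy choice. Many extensions are demanded only below the
  hyperplanes of \<open>span T\<close>, since such a hyperplane has \<open>span T\<close> as its
  only extension.\<close>

definition has_sparse_flat :: "nat \<Rightarrow> real \<Rightarrow> real \<Rightarrow> 'a::euclidean_space set \<Rightarrow> bool" where
  "has_sparse_flat j K \<delta> T \<longleftrightarrow> (\<exists>P\<subseteq>T. independent P \<and> card P = j \<and>
    real (card (parallel_pairs T (span P))) \<le> K * real (card T) \<and>
    (Suc j < dim T \<longrightarrow> \<delta> * real (card T) \<le> real (card (extensions P T))))"

text \<open>For the zero subspace the parallel pairs are the diagonal, and each point spans a line
  of its own.\<close>

lemma has_sparse_flat_0:
  fixes T :: "'a::euclidean_space set"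
  assumes T: "finite T" "\<And>x. x \<in> T \<Longrightarrow> w \<bullet> x = 1"
  shows "has_sparse_flat 0 1 1 T"
  unfolding has_sparse_flat_def
proof (intro exI[of _ "{}"] conjI impI)
  have "parallel_pairs T (span {}) = (\<lambda>x. (x, x)) ` T"
    by (auto simp: parallel_pairs_def)
  then show "real (card (parallel_pairs T (span {}))) \<le> 1 * real (card T)"
    using T by (simp add: card_image_le)
  have "T - span {} = T"
    using T by force
  then show "1 * real (card T) \<le> real (card (extensions {} T))"
    using span_singletons_inj[OF T(2)] T by (simp add: extensions_def card_image)
qed (simp_all add: independent_empty)

text \<open>The new point must meet two demands. By \<open>step\<close>, an eighth of the
  representatives keep many further extensions; these are too many for all of them to be popular, so
  one of them adds few pairs.\<close>

lemma has_sparse_flat_Suc: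
  fixes T :: "'a::euclidean_space set" and \<eta> \<epsilon> \<delta> \<delta>0 K0 :: real
  assumes T: "finite T" "T \<noteq> {}" and j: "Suc j < dim T" and few: "few_on_subspaces \<eta> T"
    and P: "has_sparse_flat j K0 \<delta>0 T" and pos: "\<delta>0 > 0" "\<delta> > 0" and \<eta>: "\<eta> \<le> \<epsilon> * \<delta>0" "\<epsilon> > 0"
    and step: "\<And>P R. P \<subseteq> T \<Longrightarrow> independent P \<Longrightarrow> card P + 3 \<le> dim T \<Longrightarrow>
      R \<subseteq> T - span P \<Longrightarrow> inj_on (\<lambda>x. span (insert x P)) R \<Longrightarrow> \<eta> * real (card T) \<le> \<epsilon> * real (card R) \<Longrightarrow>
      real (card R) / 8 \<le> card {x\<in>R. \<delta> * real (card R) \<le> real (card (extensions (insert x P) T))}"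
  shows "has_sparse_flat (Suc j) (K0 + 16 / \<delta>0) (\<delta> * \<delta>0) T"
proof -
  define n where "n = real (card T)"
  have n: "n > 0"
    using T by (simp add: n_def card_gt_0_iff)
  obtain P where P: "P \<subseteq> T" "independent P" "card P = j"
    and pairs: "real (card (parallel_pairs T (span P))) \<le> K0 * n"
    and ext: "\<delta>0 * n \<le> real (card (extensions P T))"
    using P j unfolding has_sparse_flat_def n_def by blast
  obtain R where R: "R \<subseteq> T - span P" "inj_on (\<lambda>x. span (insert x P)) R" "card R = card (extensions P T)"
    using extension_representatives by blast
  have finR: "finite R"
    using R(1) T finite_subset by blast
  have R_large: "\<delta>0 * n \<le> card R"
    using ext R by simp
  \<comment> \<open>When the new flat is already a hyperplane of \<open>span T\<close>, the
    condition is void and \<open>G\<close> is all of \<open>R\<close>.\<close>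
  define G where "G = {x\<in>R. Suc (Suc j) < dim T \<longrightarrow> \<delta> * real (card R) \<le> real (card (extensions (insert x P) T))}"
  have G: "real (card R) / 8 \<le> card G"
  proof (cases "Suc (Suc j) < dim T")
    case True
    have "\<eta> * n \<le> \<epsilon> * \<delta>0 * n"
      using \<eta> n by (intro mult_right_mono) auto
    also have "\<dots> \<le> \<epsilon> * card R"
      using R_large \<eta>(2) by simp
    finally have "\<eta> * real (card T) \<le> \<epsilon> * real (card R)"
      by (simp add: n_def)
    then show ?thesis
      using step[OF P(1,2) _ R(1,2)] True P(3) by (simp add: G_def)
  qed (simp add: G_def)
  \<comment> \<open>\<open>G\<close> has at least \<open>\<delta>0 * n / 8\<close> members; 16
    instead of 8 makes the inequality strict.\<close>
  have "n < 16 / \<delta>0 * real (card G)"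
  proof -
    have "n < 2 * n" using n by simp
    also have "2 * n = 16 / \<delta>0 * (\<delta>0 * n / 8)"
      using pos by simp
    also have "\<dots> \<le> 16 / \<delta>0 * card G"
      using pos G R_large by (intro mult_left_mono) auto
    finally show ?thesis .
  qed
  then obtain x where x: "x \<in> G" and pairs': "real (card (parallel_pairs T (span (insert x P))))
      \<le> real (card (parallel_pairs T (span P))) + 16 / \<delta>0 * real (card T)"
    using few_popular_extensions[OF T finR R(2), of G "16 / \<delta>0"] pos
    by (auto simp: G_def n_def)
  have xP: "x \<in> T" "x \<notin> span P"
    using x R(1) by (auto simp: G_def)
  show ?thesis
    unfolding has_sparse_flat_def
  proof (intro exI[of _ "insert x P"] conjI impI)
    show "insert x P \<subseteq> T" "independent (insert x P)"
      using xP P by (auto simp: independent_insert)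
    have "x \<notin> P"
      using xP(2) span_base by blast
    then show "card (insert x P) = Suc j"
      using P independent_imp_finite[OF P(2)] by simp
    show "real (card (parallel_pairs T (span (insert x P)))) \<le> (K0 + 16 / \<delta>0) * real (card T)"
      using pairs pairs' by (simp add: n_def algebra_simps)
    assume "Suc (Suc j) < dim T"
    then have "\<delta> * real (card R) \<le> real (card (extensions (insert x P) T))"
      using x by (simp add: G_def)
    moreover have "\<delta> * (\<delta>0 * n) \<le> \<delta> * real (card R)"
      using R_large pos by (intro mult_left_mono) auto
    ultimately show "\<delta> * \<delta>0 * real (card T) \<le> real (card (extensions (insert x P) T))"
      by (simp add: n_def mult.assoc)
  qed
qed

lemma sparse_flat_exists:
  "\<exists>\<eta>>0. \<exists>K>0. \<exists>\<delta>>0. \<forall>(T :: 'a::euclidean_space set) w.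
    finite T \<longrightarrow> T \<noteq> {} \<longrightarrow> (\<forall>x\<in>T. w \<bullet> x = 1) \<longrightarrow> j < dim T \<longrightarrow> few_on_subspaces \<eta> T \<longrightarrow>
    has_sparse_flat j K \<delta> T"
proof (induction j)
  case 0
  have "has_sparse_flat 0 1 1 T" if "finite T" "\<forall>x\<in>T. w \<bullet> x = 1" for T :: "'a set" and w
    using that by (intro has_sparse_flat_0[of T w]) auto
  then show ?case
    by (intro exI[of _ 1] conjI allI impI) simp_all
next
  case (Suc j)
  then obtain \<eta>0 K0 \<delta>0 :: real where pos0: "\<eta>0 > 0" "K0 > 0" "\<delta>0 > 0"
    and IH: "\<And>(T :: 'a set) w. finite T \<Longrightarrow> T \<noteq> {} \<Longrightarrow> \<forall>x\<in>T. w \<bullet> x = 1 \<Longrightarrow> j < dim T \<Longrightarrow>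
      few_on_subspaces \<eta>0 T \<Longrightarrow> has_sparse_flat j K0 \<delta>0 T"
    by blast
  obtain \<epsilon> \<delta> :: real where pos: "\<epsilon> > 0" "\<delta> > 0"
    and step: "\<And>\<eta> (T :: 'a set) P R. finite T \<Longrightarrow> P \<subseteq> T \<Longrightarrow> independent P \<Longrightarrow> card P + 3 \<le> dim T \<Longrightarrow>
      few_on_subspaces \<eta> T \<Longrightarrow> R \<subseteq> T - span P \<Longrightarrow> inj_on (\<lambda>x. span (insert x P)) R \<Longrightarrow>
      \<eta> * real (card T) \<le> \<epsilon> * real (card R) \<Longrightarrow>
      real (card R) / 8 \<le> card {x\<in>R. \<delta> * real (card R) \<le> real (card (extensions (insert x P) T))}"
    using many_extensions_step[where 'a = 'a] by blast
  \<comment> \<open>The first bound serves the induction hypothesis; the second makes proper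
    subspaces poor relative to the \<open>\<delta>0 * n\<close> available extensions.\<close>
  define \<eta> where "\<eta> = min \<eta>0 (\<epsilon> * \<delta>0)"
  have main: "has_sparse_flat (Suc j) (K0 + 16 / \<delta>0) (\<delta> * \<delta>0) T"
    if T: "finite T" "T \<noteq> {}" "\<forall>x\<in>T. w \<bullet> x = 1" and j: "Suc j < dim T" and few: "few_on_subspaces \<eta> T"
    for T :: "'a set" and w
  proof (rule has_sparse_flat_Suc[OF T(1,2) j few])
    show "has_sparse_flat j K0 \<delta>0 T"
      using IH[OF T] j few_on_subspaces_mono[OF few, of \<eta>0] by (simp add: \<eta>_def)
    show "\<eta> \<le> \<epsilon> * \<delta>0"
      by (simp add: \<eta>_def)
  qed (use pos pos0 step[OF T(1) _ _ _ few] in auto)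
  have "\<eta> > 0" "K0 + 16 / \<delta>0 > 0" "\<delta> * \<delta>0 > 0"
    using pos pos0 by (auto simp: \<eta>_def add_pos_pos)
  then show ?case
    using main
    by (intro exI[of _ \<eta>] exI[of _ "K0 + 16 / \<delta>0"] exI[of _ "\<delta> * \<delta>0"] conjI allI impI)
qed

section \<open>Many translates of a hyperplane\<close>

definition separated_modulo :: "'a::euclidean_space set \<Rightarrow> 'a set \<Rightarrow> bool" where
  "separated_modulo U Q \<longleftrightarrow> (\<forall>x\<in>Q. \<forall>y\<in>Q. x \<noteq> y \<longrightarrow> x - y \<notin> U)"

text \<open>\<open>Q\<close> takes one point from each coset of \<open>U\<close> that meets
  \<open>T\<close>; Cauchy-Schwarz compares the number of cosets with the sum of the squared coset
  sizes.\<close>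

lemma separated_subset:
  fixes T :: "'a::euclidean_space set"
  assumes T: "finite T" and U: "subspace U"
  shows "\<exists>Q\<subseteq>T. separated_modulo U Q \<and> (real (card T))\<^sup>2 \<le> real (card Q) * real (card (parallel_pairs T U))"
proof -
  \<comment> \<open>The coset of \<open>U\<close> through \<open>x\<close>.\<close>
  define f where "f x = {z. x - z \<in> U}" for x
  have f: "f x = f y \<longleftrightarrow> x - y \<in> U" for x y
  proof
    assume "f x = f y"
    moreover have "y \<in> f y"
      using subspace_0[OF U] by (simp add: f_def)
    ultimately show "x - y \<in> U"
      by (auto simp: f_def)
  next
    assume xy: "x - y \<in> U"
    have "x - z \<in> U \<longleftrightarrow> y - z \<in> U" for z
      using subspace_diff[OF U, of "x - z" "x - y"] subspace_add[OF U xy, of "y - z"] xy by auto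
    then show "f x = f y"
      by (simp add: f_def)
  qed
  obtain Q where Q: "Q \<subseteq> T" "inj_on f Q" "f ` T = f ` Q"
    using subset_image_inj[of "f ` T" f T] by auto
  define fib where "fib c = {x\<in>T. f x = c}" for c
  have "real (card T) = (\<Sum>c\<in>f ` T. real (card (fib c)))"
  proof -
    have "card (\<Union>c\<in>f ` T. fib c) = (\<Sum>c\<in>f ` T. card (fib c))"
      using T by (intro card_UN_disjoint) (auto simp: fib_def)
    moreover have "(\<Union>c\<in>f ` T. fib c) = T"
      by (auto simp: fib_def)
    ultimately show ?thesis by simp
  qed
  then have "(real (card T))\<^sup>2 \<le> real (card (f ` T)) * (\<Sum>c\<in>f ` T. (real (card (fib c)))\<^sup>2)"
    using Cauchy_Schwarz_ineq_sum[of "\<lambda>_. 1" "\<lambda>c. real (card (fib c))" "f ` T"] by simp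
  also have "(\<Sum>c\<in>f ` T. (real (card (fib c)))\<^sup>2) = real (card (parallel_pairs T U))"
  proof -
    have "card (\<Union>c\<in>f ` T. fib c \<times> fib c) = (\<Sum>c\<in>f ` T. card (fib c \<times> fib c))"
      using T by (intro card_UN_disjoint) (auto simp: fib_def)
    moreover have "(\<Union>c\<in>f ` T. fib c \<times> fib c) = parallel_pairs T U"
      by (auto simp: fib_def parallel_pairs_def simp flip: f)
    ultimately show ?thesis
      by (simp add: card_cartesian_product power2_eq_square)
  qed
  also have "card (f ` T) = card Q"
    using Q by (simp add: card_image)
  finally have "(real (card T))\<^sup>2 \<le> real (card Q) * real (card (parallel_pairs T U))" .
  moreover have "separated_modulo U Q"
    using Q(2) f by (auto simp: separated_modulo_def dest: inj_onD)
  ultimately show ?thesis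
    using Q(1) by blast
qed

text \<open>\<open>T'\<close> is the subset at which the recursion stops: \<open>P\<close> spans a
  hyperplane of \<open>span T'\<close>, while \<open>Q\<close> is measured against all of
  \<open>T\<close>.\<close>

definition has_separating_flat :: "real \<Rightarrow> 'a::euclidean_space set \<Rightarrow> bool" where
  "has_separating_flat c T \<longleftrightarrow> (\<exists>T'\<subseteq>T. \<exists>P\<subseteq>T'. \<exists>Q\<subseteq>T'. independent P \<and> Suc (card P) = dim T' \<and>
    separated_modulo (span P) Q \<and> c * real (card T) \<le> real (card Q))"

text \<open>A subspace that is rich in points of \<open>T\<close> is handled by recursion inside that subspace.\<close>
lemma separating_flat_exists:
  "\<exists>c>0. \<forall>(T :: 'a::euclidean_space set) w. finite T \<longrightarrow> T \<noteq> {} \<longrightarrow> (\<forall>x\<in>T. w \<bullet> x = 1) \<longrightarrow> dim T \<le> k \<longrightarrow>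
    has_separating_flat c T" (is "\<exists>c>0. ?claim k c")
proof (induction k)
  case 0
  have no: False if T: "T \<noteq> {}" "\<forall>x\<in>T. w \<bullet> x = 1" "dim T \<le> 0" for T :: "'a set" and w
  proof -
    obtain x where x: "x \<in> T"
      using T(1) by blast
    then have "x = 0"
      using T(3) by (auto simp: dim_eq_0)
    then show False
      using x T(2) by force
  qed
  show ?case
    by (intro exI[of _ 1] conjI allI impI, simp, rule FalseE, rule no)
next
  case (Suc k)
  then obtain c0 where c0: "c0 > 0" and IH: "?claim k c0"
    by blast
  obtain \<eta> K \<delta> :: real where pos: "\<eta> > 0" "K > 0"
    and sparse: "\<And>(T :: 'a set) w. finite T \<Longrightarrow> T \<noteq> {} \<Longrightarrow> \<forall>x\<in>T. w \<bullet> x = 1 \<Longrightarrow> k < dim T \<Longrightarrow>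
      few_on_subspaces \<eta> T \<Longrightarrow> has_sparse_flat k K \<delta> T"
    using sparse_flat_exists[of k] by blast
  \<comment> \<open>The three bounds belong to the three cases: smaller dimension, no rich proper
    subspace, and recursion into a subspace with more than the proportion \<open>\<eta>\<close> of
    the points.\<close>
  define c where "c = min c0 (min (1 / K) (c0 * \<eta>))"
  have c: "c > 0"
    using c0 pos by (simp add: c_def)
  have "?claim (Suc k) c"
  proof (intro allI impI)
    fix T :: "'a set" and w
    assume T: "finite T" "T \<noteq> {}" "\<forall>x\<in>T. w \<bullet> x = 1" and dim: "dim T \<le> Suc k"
    have n: "0 < real (card T)"
      using T by (simp add: card_gt_0_iff)
    have recurse: "has_separating_flat c T"
      if S: "S \<subseteq> T" "S \<noteq> {}" "dim S \<le> k" "c * real (card T) \<le> c0 * real (card S)" for S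
    proof -
      have "finite S" "\<forall>x\<in>S. w \<bullet> x = 1"
        using S(1) T finite_subset by auto
      then have "has_separating_flat c0 S"
        using IH S(2,3) by blast
      then show ?thesis
        using S(1,4) unfolding has_separating_flat_def by (meson order_trans)
    qed
    show "has_separating_flat c T"
    proof (cases "dim T \<le> k")
      case True
      have "c * real (card T) \<le> c0 * real (card T)"
        by (intro mult_right_mono) (auto simp: c_def)
      then show ?thesis
        using recurse[OF _ T(2) True] by simp
    next
      case False
      then have dimT: "dim T = Suc k"
        using dim by simp
      show ?thesis
      proof (cases "few_on_subspaces \<eta> T")
        case True
        obtain P where P: "P \<subseteq> T" "independent P" "card P = k"
          and pairs: "real (card (parallel_pairs T (span P))) \<le> K * real (card T)"
          using sparse[OF T _ True] dimT by (auto simp: has_sparse_flat_def)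
        obtain Q where Q: "Q \<subseteq> T" "separated_modulo (span P) Q"
          and cQ: "(real (card T))\<^sup>2 \<le> real (card Q) * real (card (parallel_pairs T (span P)))"
          using separated_subset[OF T(1) subspace_span] by blast
        note cQ
        also have "real (card Q) * real (card (parallel_pairs T (span P))) \<le> real (card Q) * (K * real (card T))"
          using pairs by (intro mult_left_mono) auto
        finally have "real (card T) * real (card T) \<le> (K * real (card Q)) * real (card T)"
          by (simp add: power2_eq_square mult_ac)
        then have "real (card T) \<le> K * real (card Q)"
          using n by simp
        then have "1 / K * real (card T) \<le> real (card Q)"
          using pos by (simp add: field_simps)
        moreover have "c * real (card T) \<le> 1 / K * real (card T)"
          by (intro mult_right_mono) (auto simp: c_def)
        ultimately have "c * real (card T) \<le> real (card Q)"
          by linarith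
        then show ?thesis
          using P Q dimT unfolding has_separating_flat_def
          by (intro exI[of _ T] exI[of _ P] exI[of _ Q] conjI) auto
      next
        case False
        then obtain U where U: "dim U < dim T" "\<eta> * real (card T) < real (card (T \<inter> U))"
          by (auto simp: few_on_subspaces_def not_le)
        have "0 < \<eta> * real (card T)"
          using n pos by simp
        then have "T \<inter> U \<noteq> {}"
          using U(2) by auto
        moreover have "dim (T \<inter> U) \<le> dim U"
          by (intro dim_subset) auto
        then have "dim (T \<inter> U) \<le> k"
          using U(1) dimT by simp
        moreover have "c * real (card T) \<le> c0 * real (card (T \<inter> U))"
        proof -
          have "c * real (card T) \<le> c0 * \<eta> * real (card T)"
            by (intro mult_right_mono) (auto simp: c_def)
          also have "\<dots> \<le> c0 * real (card (T \<inter> U))"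
            using U(2) c0 by simp
          finally show ?thesis .
        qed
        ultimately show ?thesis
          by (intro recurse) auto
      qed
    qed
  qed
  then show ?case
    using c by blast
qed

text \<open>A point \<open>x\<close> completes \<open>P\<close> to a basis of
  \<open>span T'\<close>, which is extended within \<open>T\<close> to a basis of the whole space;
  then \<open>x\<close> is removed. This enlarges \<open>P\<close> in directions transversal to
  \<open>span T'\<close>, so no two points of \<open>Q\<close> become parallel.\<close>

lemma separated_modulo_hyperplane:
  "\<exists>c>0. \<forall>(T :: 'a::euclidean_space set) w. finite T \<longrightarrow> (\<forall>x\<in>T. w \<bullet> x = 1) \<longrightarrow> span T = UNIV \<longrightarrow>
    (\<exists>B\<subseteq>T. \<exists>Q\<subseteq>T. independent B \<and> Suc (card B) = DIM('a) \<and> separated_modulo (span B) Q \<and>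
      c * real (card T) \<le> real (card Q))"
proof -
  obtain c :: real where c: "c > 0" and flat: "\<And>(T :: 'a set) w. finite T \<Longrightarrow> T \<noteq> {} \<Longrightarrow> \<forall>x\<in>T. w \<bullet> x = 1 \<Longrightarrow>
      dim T \<le> DIM('a) \<Longrightarrow> has_separating_flat c T"
    using separating_flat_exists[of "DIM('a)"] by blast
  have main: "\<exists>B\<subseteq>T. \<exists>Q\<subseteq>T. independent B \<and> Suc (card B) = DIM('a) \<and> separated_modulo (span B) Q \<and>
      c * real (card T) \<le> real (card Q)"
    if T: "finite T" "\<forall>x\<in>T. w \<bullet> x = 1" "span T = UNIV" for T :: "'a set" and w
  proof -
    have "T \<noteq> {}"
      using T(3) by (metis DIM_positive dim_UNIV dim_empty dim_span less_irrefl)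
    then obtain T' P Q where T': "T' \<subseteq> T" "P \<subseteq> T'" "Q \<subseteq> T'" "independent P" "Suc (card P) = dim T'"
        "separated_modulo (span P) Q" "c * real (card T) \<le> real (card Q)"
      using flat[OF T(1) _ T(2)] dim_subset_UNIV[of T] unfolding has_separating_flat_def by metis
    have "\<not> T' \<subseteq> span P"
    proof
      assume "T' \<subseteq> span P"
      then have "dim T' \<le> card P"
        using independent_imp_finite[OF T'(4)] by (intro dim_le_card)
      then show False
        using T'(5) by simp
    qed
    then obtain x where x: "x \<in> T'" "x \<notin> span P"
      by blast
    have "x \<notin> P"
      using x(2) span_base by blast
    have xP: "independent (insert x P)" "insert x P \<subseteq> T'" "card (insert x P) = dim T'"
      using x \<open>x \<notin> P\<close> T' independent_imp_finite[OF T'(4)] by (auto simp: independent_insert)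
    then have T'_span: "T' \<subseteq> span (insert x P)"
      by (intro card_ge_dim_independent) auto
    obtain B where B: "insert x P \<subseteq> B" "B \<subseteq> T" "independent B" "T \<subseteq> span B"
      using maximal_independent_subset_extend[of "insert x P" T] xP T'(1) by blast
    have "span B = UNIV"
      using B(4) T(3) span_mono[of T "span B"] by (auto simp: span_span)
    then have cardB: "card B = DIM('a)"
      using B(3) dim_eq_card_independent[of B] by (metis dim_UNIV dim_span)
    have finB: "finite B"
      using B(3) independent_imp_finite by blast
    have xB: "x \<notin> span (B - {x})"
      using B(1,3) by (auto simp: dependent_def)
    have P_sub: "span P \<subseteq> span (B - {x})"
      using B(1) \<open>x \<notin> P\<close> by (intro span_mono) auto
    have "separated_modulo (span (B - {x})) Q"
      unfolding separated_modulo_def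
    proof (intro ballI impI notI)
      fix y z assume yz: "y \<in> Q" "z \<in> Q" "y \<noteq> z" "y - z \<in> span (B - {x})"
      have "y - z \<in> span (insert x P)"
        using yz T'(3) T'_span by (intro span_diff) auto
      then obtain s where s: "y - z - s *\<^sub>R x \<in> span P"
        by (auto simp: span_breakdown_eq)
      then have "(y - z) - (y - z - s *\<^sub>R x) \<in> span (B - {x})"
        by (rule span_diff[OF yz(4) subsetD[OF P_sub]])
      then have "s *\<^sub>R x \<in> span (B - {x})"
        by simp
      \<comment> \<open>Otherwise \<open>x\<close> would lie in the span of the other basis
        vectors.\<close>
      then have "s = 0"
        using xB span_scale[of "s *\<^sub>R x" "B - {x}" "1 / s"] by (cases "s = 0") auto
      then show False
        using s yz T'(6) by (auto simp: separated_modulo_def)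
    qed
    moreover have "independent (B - {x})"
      using B(3) independent_mono by blast
    moreover have "Suc (card (B - {x})) = DIM('a)"
      using cardB finB B(1) by (metis card_Suc_Diff1 insert_subset)
    ultimately show ?thesis
      using B(2) T' by (intro exI[of _ "B - {x}"] exI[of _ Q] conjI) auto
  qed
  then show ?thesis
    using c by blast
qed

subsection \<open>Distinct volumes\<close>

definition lift_point :: "'a::euclidean_space \<Rightarrow> 'a \<times> real" where
  "lift_point x = (x, 1)"

lemma inj_lift_point: "inj lift_point"
  by (auto simp: inj_def lift_point_def)

text \<open>The last coordinate of the lift records the sum of the coefficients, so an affine
  dependence lifts to a linear one.\<close>

lemma affine_independent_of_lift:
  fixes V :: "'a::euclidean_space set"
  assumes "independent (lift_point ` V)"
  shows "\<not> affine_dependent V"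
proof
  assume dep: "affine_dependent V"
  have finV: "finite V"
    using independent_imp_finite[OF assms] inj_on_subset[OF inj_lift_point] by (rule finite_imageD) simp
  obtain u v where u: "sum u V = 0" "(\<Sum>x\<in>V. u x *\<^sub>R x) = 0" and v: "v \<in> V" "u v \<noteq> 0"
    using dep affine_dependent_explicit_finite[OF finV] by auto
  have inv: "inv lift_point (lift_point x) = x" for x :: 'a
    using inj_lift_point by (rule inv_f_f)
  have "(\<Sum>z\<in>lift_point ` V. u (inv lift_point z) *\<^sub>R z) = (\<Sum>x\<in>V. u x *\<^sub>R lift_point x)"
    using inj_lift_point inv by (subst sum.reindex) (auto intro: inj_on_subset)
  also have "\<dots> = 0"
    using u by (intro prod_eqI) (simp_all add: lift_point_def fst_sum snd_sum)
  finally have "u (inv lift_point (lift_point v)) = 0"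
    using assms v(1) finV by (intro independentD[of "lift_point ` V" "lift_point ` V"]) auto
  then show False
    using v(2) inv by simp
qed

text \<open>A normal vector \<open>(a, b)\<close> of a proper span puts \<open>S\<close> on the
  hyperplane \<open>a \<bullet> x = -b\<close>. If \<open>a = 0\<close>, then
  \<open>b \<noteq> 0\<close> forces \<open>S\<close> to be empty, and any hyperplane contains
  it.\<close>

lemma span_lift_point:
  fixes S :: "'a::euclidean_space set"
  assumes "\<not> on_hyperplane S"
  shows "span (lift_point ` S) = UNIV"
proof (rule ccontr)
  assume "span (lift_point ` S) \<noteq> UNIV"
  then have "dim (lift_point ` S) < DIM('a \<times> real)"
    by (metis dim_eq_full dim_subset_UNIV le_neq_implies_less)
  then obtain g where g: "g \<noteq> 0" "span (lift_point ` S) \<subseteq> {z. g \<bullet> z = 0}"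
    using lowdim_subset_hyperplane by blast
  obtain a b where ab: "g = (a, b)"
    by (cases g)
  have eq: "a \<bullet> x = -b" if "x \<in> S" for x
  proof -
    have "g \<bullet> lift_point x = 0"
      using g(2) that by (auto intro: span_base)
    then show ?thesis
      by (simp add: ab lift_point_def)
  qed
  obtain e :: 'a where e: "e \<noteq> 0"
    using nonempty_Basis nonzero_Basis by blast
  show False
  proof (cases "a = 0")
    case True
    then have "S = {}"
      using eq g(1) by (auto simp: ab zero_prod_def)
    then show False
      using assms e by (auto simp: on_hyperplane_def)
  next
    case False
    then show False
      using assms eq by (auto simp: on_hyperplane_def)
  qed
qed

text \<open>The factor 2 pays for pairs of points at equal distance on opposite sides of the
  facet.\<close>

lemma card_le_abs_image:
  fixes f :: "'a \<Rightarrow> real"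
  assumes "finite Q" "inj_on f Q"
  shows "card Q \<le> 2 * card ((\<lambda>x. \<bar>f x\<bar>) ` Q)"
proof -
  define A where "A = (\<lambda>x. \<bar>f x\<bar>) ` Q"
  have "f ` Q \<subseteq> A \<union> uminus ` A"
  proof
    fix y assume "y \<in> f ` Q"
    then have "\<bar>y\<bar> \<in> A"
      by (auto simp: A_def)
    then show "y \<in> A \<union> uminus ` A"
      by (cases "0 \<le> y") (auto simp: image_iff intro!: bexI[of _ "\<bar>y\<bar>"])
  qed
  then have "card (f ` Q) \<le> card (A \<union> uminus ` A)"
    using assms by (intro card_mono) (auto simp: A_def)
  also have "\<dots> \<le> card A + card (uminus ` A)"
    by (rule card_Un_le)
  also have "\<dots> \<le> 2 * card A"
    using card_image_le[of A uminus] assms by (simp add: A_def)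
  finally show ?thesis
    using assms by (simp add: A_def card_image)
qed

text \<open>The signed volume over the facet is an affine function \<open>\<phi>\<close> whose
  lifted zero set is exactly \<open>span B\<close>, so it takes distinct values on points separated
  modulo \<open>span B\<close>. Factors of 2 are lost to the sign and to the value 0.\<close>

lemma simplices_over_common_facet:
  fixes S :: "(real ^ 'd) set"
  assumes S: "finite S" and B: "B \<subseteq> lift_point ` S" "independent B" "card B = CARD('d)"
    and span: "span (lift_point ` S) = UNIV"
    and Q: "Q \<subseteq> lift_point ` S" "separated_modulo (span B) Q"
  shows "\<exists>F \<in> spanned_simplices (int CARD('d) - 1) S. \<exists>\<T> \<subseteq> full_simplices S.
    finite \<T> \<and> (\<forall>T \<in> \<T>. F face_of T) \<and> inj_on (measure lborel) \<T> \<and> card Q \<le> 4 * card \<T>"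
proof -
  have inj: "inj_on lift_point A" for A :: "(real ^ 'd) set"
    using inj_lift_point by (rule inj_on_subset) simp
  obtain F where F: "F \<subseteq> S" "B = lift_point ` F"
    using B(1) by (auto simp: subset_image_iff)
  have finF: "finite F" and cardF: "card F = CARD('d)"
    using F S B(3) inj finite_subset by (auto simp: card_image)
  have F_indep: "\<not> affine_dependent F"
    using affine_independent_of_lift[of F] B(2) F(2) by simp
  obtain \<nu> b where on: "\<And>p. p \<in> F \<Longrightarrow> \<nu> \<bullet> p = b"
    and vol: "\<And>x. x \<notin> F \<Longrightarrow> measure lborel (convex hull (insert x F)) = \<bar>\<nu> \<bullet> x - b\<bar>"
    using simplex_content_affine[OF finF cardF] by metis
  define \<phi> where "\<phi> x = \<nu> \<bullet> x - b" for x
  define H where "H = {z. (\<nu>, -b) \<bullet> z = 0}"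
  have H: "subspace H"
    unfolding H_def by (rule subspace_hyperplane)
  have \<phi>: "(\<nu>, -b) \<bullet> lift_point x = \<phi> x" for x
    by (simp add: lift_point_def \<phi>_def)
  have H_lift: "lift_point x \<in> H \<longleftrightarrow> \<phi> x = 0" for x
    by (simp add: H_def \<phi>)
  have BH: "span B \<subseteq> H"
    using H on F(2) by (intro span_minimal) (auto simp: H_def lift_point_def)
  have new_vertex: "\<not> affine_dependent (insert x F) \<and> card (insert x F) = CARD('d) + 1 \<and> x \<notin> F"
    if "lift_point x \<notin> span B" for x
  proof -
    have "x \<notin> F"
      using that span_base[of "lift_point x" B] F(2) by auto
    moreover have "independent (lift_point ` insert x F)"
      using that B(2) F(2) by (simp add: independent_insert)
    ultimately show ?thesis
      using affine_independent_of_lift[of "insert x F"] finF cardF by simp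
  qed
  \<comment> \<open>Needed for \<open>H\<close> to be a proper subspace; the reverse inclusion
    \<open>H \<subseteq> span B\<close> then follows by comparing dimensions.\<close>
  have "\<exists>y\<in>S. \<phi> y \<noteq> 0"
  proof -
    have "\<not> lift_point ` S \<subseteq> span B"
    proof
      assume "lift_point ` S \<subseteq> span B"
      then have "dim (lift_point ` S) \<le> card B"
        using independent_imp_finite[OF B(2)] by (intro dim_le_card)
      moreover have "dim (lift_point ` S) = DIM((real ^ 'd) \<times> real)"
        using span by (metis dim_UNIV dim_span)
      ultimately show False
        using B(3) by simp
    qed
    then obtain y where y: "y \<in> S" "lift_point y \<notin> span B"
      by blast
    then have "0 < measure lborel (convex hull (insert y F))"
      using new_vertex[of y] by (intro content_simplex_pos) auto
    then show ?thesis
      using vol[of y] new_vertex[OF y(2)] y(1) by (auto simp: \<phi>_def)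
  qed
  then obtain y where y: "y \<in> S" "\<phi> y \<noteq> 0"
    by blast
  have "H \<noteq> UNIV"
    using y(2) H_lift[of y] by auto
  then have "dim H < DIM((real ^ 'd) \<times> real)"
    using H by (metis dim_eq_full dim_subset_UNIV le_neq_implies_less span_eq_iff)
  then have HB: "H \<subseteq> span B"
    using BH B(2,3) span_superset[of B] by (intro card_ge_dim_independent) auto
  have \<phi>_zero: "\<phi> x \<noteq> 0 \<longleftrightarrow> lift_point x \<notin> span B" for x
    using BH HB H_lift[of x] by auto
  \<comment> \<open>The volumes attained over the facet, without the degenerate value 0;
    \<open>X\<close> will pick one apex for each.\<close>
  define V where "V = (\<lambda>x. \<bar>\<phi> x\<bar>) ` S - {0}"
  have finV: "finite V"
    using S by (simp add: V_def)
  have "V \<subseteq> (\<lambda>x. \<bar>\<phi> x\<bar>) ` S"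
    by (auto simp: V_def)
  then have "\<exists>X. X \<subseteq> S \<and> inj_on (\<lambda>x. \<bar>\<phi> x\<bar>) X \<and> V = (\<lambda>x. \<bar>\<phi> x\<bar>) ` X"
    by (rule subset_image_inj[THEN iffD1])
  then obtain X where X: "X \<subseteq> S" "inj_on (\<lambda>x. \<bar>\<phi> x\<bar>) X" "V = (\<lambda>x. \<bar>\<phi> x\<bar>) ` X"
    by auto
  have finX: "finite X"
    using X(1) S finite_subset by blast
  have X_vertex: "\<not> affine_dependent (insert x F)" "card (insert x F) = CARD('d) + 1"
      "measure lborel (convex hull (insert x F)) = \<bar>\<phi> x\<bar>" if "x \<in> X" for x
  proof -
    have "\<bar>\<phi> x\<bar> \<in> V"
      using that X(3) by blast
    then have "lift_point x \<notin> span B"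
      using \<phi>_zero by (auto simp: V_def)
    then show "\<not> affine_dependent (insert x F)" "card (insert x F) = CARD('d) + 1"
        "measure lborel (convex hull (insert x F)) = \<bar>\<phi> x\<bar>"
      using new_vertex[of x] vol[of x] by (auto simp: \<phi>_def)
  qed
  define \<T> where "\<T> = (\<lambda>x. convex hull (insert x F)) ` X"
  have "\<T> \<subseteq> full_simplices S"
    unfolding \<T>_def full_simplices_def spanned_simplices_def using X_vertex(1,2) X(1) F(1)
    by fastforce
  moreover have "\<forall>T\<in>\<T>. convex hull F face_of T"
  proof
    fix T assume "T \<in> \<T>"
    then obtain x where "x \<in> X" "T = convex hull (insert x F)"
      by (auto simp: \<T>_def)
    then show "convex hull F face_of T"
      using face_of_convex_hull_affine_independent[OF X_vertex(1)] by blast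
  qed
  moreover have "inj_on (measure lborel) \<T>"
  proof (rule inj_onI)
    fix T T' assume T: "T \<in> \<T>" "T' \<in> \<T>" "measure lborel T = measure lborel T'"
    then obtain x x' where x: "x \<in> X" "T = convex hull (insert x F)" "x' \<in> X" "T' = convex hull (insert x' F)"
      by (auto simp: \<T>_def)
    then have "x = x'"
      using T(3) X_vertex(3) X(2) by (auto dest: inj_onD)
    then show "T = T'"
      using x by simp
  qed
  moreover have "convex hull F \<in> spanned_simplices (int CARD('d) - 1) S"
    unfolding spanned_simplices_def using F(1) F_indep cardF by auto
  moreover have "card Q \<le> 4 * card \<T>"
  proof -
    have "inj_on (\<lambda>x. convex hull (insert x F)) X"
      using X_vertex(3) X(2) by (intro inj_onI) (metis inj_onD)
    then have "card \<T> = card V"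
      using X by (simp add: \<T>_def card_image)
    obtain Q' where Q': "Q' \<subseteq> S" "Q = lift_point ` Q'"
      using Q(1) by (auto simp: subset_image_iff)
    have "inj_on \<phi> Q'"
    proof (rule inj_onI)
      fix x z assume xz: "x \<in> Q'" "z \<in> Q'" "\<phi> x = \<phi> z"
      then have "lift_point x - lift_point z \<in> H"
        by (simp add: H_def inner_diff_right \<phi>)
      then have "lift_point x - lift_point z \<in> span B"
        using HB by blast
      then have "lift_point x = lift_point z"
        using Q(2) Q'(2) xz by (auto simp: separated_modulo_def)
      then show "x = z"
        by (simp add: lift_point_def)
    qed
    then have "card Q' \<le> 2 * card ((\<lambda>x. \<bar>\<phi> x\<bar>) ` Q')"
      using Q'(1) S finite_subset by (intro card_le_abs_image) auto
    also have "card ((\<lambda>x. \<bar>\<phi> x\<bar>) ` Q') \<le> card (insert 0 V)"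
      using Q'(1) finV by (intro card_mono) (auto simp: V_def)
    also have "\<dots> \<le> card V + 1"
      using finV by (simp add: card_insert_if)
    finally have "card Q' \<le> 2 * card V + 2"
      by simp
    \<comment> \<open>\<open>V\<close> is nonempty, so the additive 2, which came from the value 0,
      is absorbed into \<open>4 * card V\<close>.\<close>
    moreover have "\<bar>\<phi> y\<bar> \<in> V"
      using y by (auto simp: V_def)
    then have "card V \<ge> 1"
      using finV by (metis card_0_eq empty_iff less_one not_less)
    moreover have "card Q = card Q'"
      using Q'(2) inj by (simp add: card_image)
    ultimately show ?thesis
      using \<open>card \<T> = card V\<close> by simp
  qed
  moreover have "finite \<T>"
    using finX by (simp add: \<T>_def)
  ultimately show ?thesis
    by blast
qed

text \<open>Since \<open>card\<close> is 0 on infinite sets, comparing the number of volumes with a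
  subfamily requires finiteness.\<close>

lemma finite_full_simplices: "finite S \<Longrightarrow> finite (full_simplices S)"
  unfolding full_simplices_def spanned_simplices_def
  by (rule finite_subset[of _ "(hull) convex ` Pow S"]) auto

theorem theorem7:
  shows "\<exists>c::real. c > 0 \<and>
    (\<forall>(n::nat) (S :: (real ^ 'd) set).
      finite S \<longrightarrow> card S = n \<longrightarrow> \<not> on_hyperplane S \<longrightarrow>
        real (card (measure lborel ` full_simplices S)) \<ge> c * real n \<and>
        (\<exists>F \<in> spanned_simplices (int CARD('d) - 1) S.
          \<exists>\<T> \<subseteq> full_simplices S.
            (\<forall>T \<in> \<T>. F face_of T) \<and> inj_on (measure lborel) \<T> \<and>
            real (card \<T>) \<ge> c * real n))"
proof -
  obtain c :: real where c: "c > 0" and sep: "\<And>(T :: ((real ^ 'd) \<times> real) set) w.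
      finite T \<Longrightarrow> \<forall>x\<in>T. w \<bullet> x = 1 \<Longrightarrow> span T = UNIV \<Longrightarrow>
      \<exists>B\<subseteq>T. \<exists>Q\<subseteq>T. independent B \<and> Suc (card B) = DIM((real ^ 'd) \<times> real) \<and>
        separated_modulo (span B) Q \<and> c * real (card T) \<le> real (card Q)"
    using separated_modulo_hyperplane[where 'a = "(real ^ 'd) \<times> real"] by blast
  have "real (card (measure lborel ` full_simplices S)) \<ge> c / 4 * real (card S) \<and>
      (\<exists>F \<in> spanned_simplices (int CARD('d) - 1) S. \<exists>\<T> \<subseteq> full_simplices S.
        (\<forall>T \<in> \<T>. F face_of T) \<and> inj_on (measure lborel) \<T> \<and> real (card \<T>) \<ge> c / 4 * real (card S))"
    if S: "finite S" "\<not> on_hyperplane S" for S :: "(real ^ 'd) set"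
  proof -
    \<comment> \<open>The projection to the last coordinate is the functional \<open>w\<close> that
      is constantly 1 on the lifted points.\<close>
    have "\<forall>z\<in>lift_point ` S. (0, 1) \<bullet> z = 1"
      by (auto simp: lift_point_def)
    then obtain B Q where BQ: "B \<subseteq> lift_point ` S" "Q \<subseteq> lift_point ` S" "independent B"
      "Suc (card B) = DIM((real ^ 'd) \<times> real)" "separated_modulo (span B) Q"
      "c * real (card (lift_point ` S)) \<le> real (card Q)"
      using sep[of "lift_point ` S" "(0, 1)"] span_lift_point[OF S(2)] S(1) by blast
    have "card B = CARD('d)"
      using BQ(4) by simp
    then obtain F \<T> where F: "F \<in> spanned_simplices (int CARD('d) - 1) S" and \<T>: "\<T> \<subseteq> full_simplices S"
        "finite \<T>" "\<forall>T \<in> \<T>. F face_of T" "inj_on (measure lborel) \<T>" "card Q \<le> 4 * card \<T>"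
      using simplices_over_common_facet[OF S(1) BQ(1,3) _ span_lift_point[OF S(2)] BQ(2,5)] by blast
    have "card (lift_point ` S) = card S"
      using inj_lift_point by (intro card_image) (rule inj_on_subset, auto)
    then have large: "c / 4 * real (card S) \<le> card \<T>"
      using BQ(6) \<T>(5) by simp
    have "card \<T> = card (measure lborel ` \<T>)"
      using \<T>(4) by (simp add: card_image)
    also have "\<dots> \<le> card (measure lborel ` full_simplices S)"
      using \<T>(1) finite_full_simplices[OF S(1)] by (intro card_mono) auto
    finally show ?thesis
      using F \<T> large by (intro conjI bexI[of _ F] exI[of _ \<T>]) auto
  qed
  then show ?thesis
    using c by (intro exI[of _ "c / 4"]) auto
qed

end
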